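(* Let $n\ge 2$, let $D_F\subset\mathbb{C}^n$ be an $n$-dimensional strongly pseudoconvex Hartogs domain, and let $g_F$ be the associated Kähler metric on $D_F$. Assume that $g_F$ is an extremal Kähler metric. Then $(D_F,g_F)$ is holomorphically isometric to an open subset of the $n$-dimensional complex hyperbolic space $(\mathbb{C}H^n,g_{hyp})$.
   Context: Hartogs domain: let $x_0\in\mathbb{R}^+\cup\{+\infty\}$ (with $\mathbb{R}^+=(0,+\infty)$) and let $F:[0,x_0)\to(0,+\infty)$ be a decreasing continuous function, smooth on $(0,x_0)$. The Hartogs domain associated to $F$ is $$D_F=\{(z_0,z_1,\dots,z_{n-1})\in\mathbb{C}^n : |z_0|^2<x_0,\ |z_1|^2+\cdots+|z_{n-1}|^2<F(|z_0|^2)\}.$$ Put $$\omega_F=\frac{i}{2}\partial\overline{\partial}\log\frac{1}{F(|z_0|^2)-|z_1|^2-\cdots-|z_{n-1}|^2}.$$ "Strongly pseudoconvex Hartogs domain" means that $\omega_F$ is a (smooth, positive definite) Kähler form on $D_F$; in particular $F(|z_0|^2)$ is a smooth function of $z_0$ also at $z_0=0$. The metric $g_F$ is the Kähler metric with Kähler form $\omega_F=\frac{i}{2}\sum_{\alpha,\beta=0}^{n-1}g_{\alpha\bar\beta}\,dz_\alpha\wedge d\bar z_\beta$. Complex hyperbolic space: $(\mathbb{C}H^n,g_{hyp})$ is $(D_F,g_F)$ for $F(x)=1-x$, $0\le x<1$, i.e. the unit ball of $\mathbb{C}^n$ with Kähler form $\frac{i}{2}\partial\overline{\partial}\log\frac{1}{1-\sum_{j=0}^{n-1}|z_j|^2}$.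 Two Kähler manifolds are holomorphically isometric if there is a biholomorphism between them that is an isometry of the Kähler metrics. Curvature: for a Kähler metric $g$ with local components $g_{\alpha\bar\beta}$, $\mathrm{Ric}_{\alpha\bar\beta}=-\frac{\partial^2}{\partial z_\alpha\partial\bar z_\beta}\log\det(g_{\gamma\bar\delta})$ and $\mathrm{scal}_g=\sum_{\alpha,\beta}g^{\beta\bar\alpha}\mathrm{Ric}_{\alpha\bar\beta}$, where $g^{\beta\bar\alpha}$ are the entries of the inverse matrix: $\sum_{\alpha}g^{\beta\bar\alpha}g_{\alpha\bar\gamma}=\delta_{\beta\gamma}$. Extremal metric: a Kähler metric $g$ on an $n$-dimensional complex manifold (compact or not) is extremal if the $(1,0)$-part of the Hamiltonian vector field associated to $\mathrm{scal}_g$ is holomorphic; equivalently, in local holomorphic coordinates $(z_0,\dots,z_{n-1})$, $$\frac{\partial}{\partial\bar z_\gamma}\left(\sum_{\beta=0}^{n-1}g^{\beta\bar\alpha}\frac{\partial\,\mathrm{scal}_g}{\partial\bar z_\beta}\right)=0\qquad\text{for all }\alpha,\gamma=0,\dots,n-1.$$ *)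

theory Defs
  imports "HOL-Analysis.Analysis"
begin

text \<open>
  A Kaehler metric on an open subset \<open>U\<close> of the complex coordinate space \<open>complex ^ 'n\<close> is given by
  its matrix of components in the global coordinates: \<open>g z $ \<alpha> $ \<beta>\<close> is the
  coefficient \<open>g\<^bsub>\<alpha>\<beta>bar\<^esub>\<close> in
  \<open>\<omega> = i/2 \<Sum> g\<^bsub>\<alpha>\<beta>bar\<^esub> dz\<^sub>\<alpha> \<and> dzbar\<^sub>\<beta>\<close>.
\<close>

subsection \<open>Differentiability and Wirtinger derivatives\<close>

text \<open>
  \<open>Ck_on k S f\<close> is used for open \<open>S\<close> in a finite-dimensional space, where it is the usual class
  \<open>C\<^sup>k\<close>.
\<close>

primrec Ck_on :: "nat \<Rightarrow> 'a::real_normed_vector set \<Rightarrow> ('a \<Rightarrow> 'b::real_normed_vector) \<Rightarrow> bool" where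
  "Ck_on 0 S f \<longleftrightarrow> continuous_on S f"
| "Ck_on (Suc k) S f \<longleftrightarrow>
     (\<forall>x\<in>S. f differentiable (at x)) \<and> (\<forall>v. Ck_on k S (\<lambda>x. frechet_derivative f (at x) v))"

definition smooth_on :: "'a::real_normed_vector set \<Rightarrow> ('a \<Rightarrow> 'b::real_normed_vector) \<Rightarrow> bool" where
  "smooth_on S f \<longleftrightarrow> (\<forall>k. Ck_on k S f)"

definition d_z :: "'n::finite \<Rightarrow> (complex ^ 'n \<Rightarrow> complex) \<Rightarrow> complex ^ 'n \<Rightarrow> complex" where
  "d_z \<alpha> f z = (frechet_derivative f (at z) (axis \<alpha> 1)
      - \<i> * frechet_derivative f (at z) (axis \<alpha> \<i>)) / 2"

definition d_zbar :: "'n::finite \<Rightarrow> (complex ^ 'n \<Rightarrow> complex) \<Rightarrow> complex ^ 'n \<Rightarrow> complex" where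
  "d_zbar \<alpha> f z = (frechet_derivative f (at z) (axis \<alpha> 1)
      + \<i> * frechet_derivative f (at z) (axis \<alpha> \<i>)) / 2"

definition complex_hessian :: "(complex ^ 'n::finite \<Rightarrow> complex) \<Rightarrow> complex ^ 'n \<Rightarrow> complex ^ 'n ^ 'n" where
  "complex_hessian \<phi> z = (\<chi> \<alpha> \<beta>. d_z \<alpha> (d_zbar \<beta> \<phi>) z)"

subsection \<open>Kaehler metrics\<close>

definition hermitian_form :: "complex ^ 'n ^ 'n \<Rightarrow> complex ^ 'n \<Rightarrow> complex ^ 'n::finite \<Rightarrow> complex" where
  "hermitian_form A u v = (\<Sum>\<alpha>\<in>UNIV. \<Sum>\<beta>\<in>UNIV. A $ \<alpha> $ \<beta> * u $ \<alpha> * cnj (v $ \<beta>))"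

definition hermitian_posdef :: "complex ^ 'n ^ 'n::finite \<Rightarrow> bool" where
  "hermitian_posdef A \<longleftrightarrow>
     (\<forall>\<alpha> \<beta>. A $ \<beta> $ \<alpha> = cnj (A $ \<alpha> $ \<beta>)) \<and>
     (\<forall>v. v \<noteq> 0 \<longrightarrow> 0 < Re (hermitian_form A v v))"

text \<open>
  The last conjunct is \<open>d\<omega> = 0\<close>: its \<open>(2,1)\<close>-part vanishes, and the
  \<open>(1,2)\<close>-part is the conjugate of the \<open>(2,1)\<close>-part because the components are Hermitian.
\<close>

definition kahler_metric_on :: "(complex ^ 'n::finite) set \<Rightarrow> (complex ^ 'n \<Rightarrow> complex ^ 'n ^ 'n) \<Rightarrow> bool" where
  "kahler_metric_on U g \<longleftrightarrow>
     open U \<and>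
     (\<forall>\<alpha> \<beta>. smooth_on U (\<lambda>z. g z $ \<alpha> $ \<beta>)) \<and>
     (\<forall>z\<in>U. hermitian_posdef (g z)) \<and>
     (\<forall>z\<in>U. \<forall>\<alpha> \<beta> \<gamma>. d_z \<gamma> (\<lambda>w. g w $ \<alpha> $ \<beta>) z = d_z \<alpha> (\<lambda>w. g w $ \<gamma> $ \<beta>) z)"

text \<open>
  The Riemannian metric with \<open>\<omega>(u, v) = riem (i u, v)\<close>, on real tangent vectors
  identified with elements of the coordinate space.
\<close>

definition riem :: "(complex ^ 'n::finite \<Rightarrow> complex ^ 'n ^ 'n) \<Rightarrow> complex ^ 'n \<Rightarrow> complex ^ 'n \<Rightarrow> complex ^ 'n \<Rightarrow> real" where
  "riem g z u v = Re (hermitian_form (g z) u v)"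

text \<open>\<open>ln\<close> is the principal complex logarithm; the determinant of a Kaehler metric is a positive real.\<close>

definition ricci :: "(complex ^ 'n::finite \<Rightarrow> complex ^ 'n ^ 'n) \<Rightarrow> complex ^ 'n \<Rightarrow> complex ^ 'n ^ 'n" where
  "ricci g z = - complex_hessian (\<lambda>w. ln (det (g w))) z"

text \<open>
  The inverse-metric coefficient written with upper indices \<open>\<beta>\<close>, \<open>\<alpha>bar\<close> is the entry
  \<open>matrix_inv (g z) $ \<beta> $ \<alpha>\<close>.
\<close>

definition scal :: "(complex ^ 'n::finite \<Rightarrow> complex ^ 'n ^ 'n) \<Rightarrow> complex ^ 'n \<Rightarrow> complex" where
  "scal g z = (\<Sum>\<alpha>\<in>UNIV. \<Sum>\<beta>\<in>UNIV. matrix_inv (g z) $ \<beta> $ \<alpha> * ricci g z $ \<alpha> $ \<beta>)"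

text \<open>Component \<open>\<alpha>\<close> of the \<open>(1,0)\<close>-vector field of the scalar curvature.\<close>

definition scal_field :: "(complex ^ 'n::finite \<Rightarrow> complex ^ 'n ^ 'n) \<Rightarrow> 'n \<Rightarrow> complex ^ 'n \<Rightarrow> complex" where
  "scal_field g \<alpha> z = (\<Sum>\<beta>\<in>UNIV. matrix_inv (g z) $ \<beta> $ \<alpha> * d_zbar \<beta> (scal g) z)"

definition extremal_on :: "(complex ^ 'n::finite) set \<Rightarrow> (complex ^ 'n \<Rightarrow> complex ^ 'n ^ 'n) \<Rightarrow> bool" where
  "extremal_on U g \<longleftrightarrow>
     kahler_metric_on U g \<and> (\<forall>z\<in>U. \<forall>\<alpha> \<gamma>. d_zbar \<gamma> (scal_field g \<alpha>) z = 0)"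

subsection \<open>Holomorphic isometries\<close>

definition holomorphic_map_on :: "(complex ^ 'n::finite) set \<Rightarrow> (complex ^ 'n \<Rightarrow> complex ^ 'n) \<Rightarrow> bool" where
  "holomorphic_map_on U \<phi> \<longleftrightarrow>
     (\<forall>z\<in>U. \<exists>A :: complex ^ 'n ^ 'n. (\<phi> has_derivative (\<lambda>v. A *v v)) (at z))"

definition biholomorphism :: "(complex ^ 'n::finite) set \<Rightarrow> (complex ^ 'n) set \<Rightarrow> (complex ^ 'n \<Rightarrow> complex ^ 'n) \<Rightarrow> bool" where
  "biholomorphism U V \<phi> \<longleftrightarrow>
     bij_betw \<phi> U V \<and> holomorphic_map_on U \<phi> \<and> holomorphic_map_on V (inv_into U \<phi>)"

definition holomorphically_isometric ::
    "(complex ^ 'n::finite) set \<Rightarrow> (complex ^ 'n \<Rightarrow> complex ^ 'n ^ 'n) \<Rightarrow>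
     (complex ^ 'n) set \<Rightarrow> (complex ^ 'n \<Rightarrow> complex ^ 'n ^ 'n) \<Rightarrow> bool" where
  "holomorphically_isometric U g V h \<longleftrightarrow>
     (\<exists>\<phi>. biholomorphism U V \<phi> \<and>
       (\<forall>z\<in>U. \<forall>u v. riem h (\<phi> z) (frechet_derivative \<phi> (at z) u) (frechet_derivative \<phi> (at z) v)
          = riem g z u v))"

subsection \<open>Hartogs domains\<close>

text \<open>
  The coordinates are indexed by an arbitrary finite type \<open>'n\<close>; the index \<open>i0 :: 'n\<close> plays the role
  of the index \<open>0\<close> of the distinguished coordinate \<open>z\<^sub>0\<close>. Only the values of \<open>F\<close> on
  \<open>[0, x0)\<close> matter.
\<close>

definition hartogs_function :: "ereal \<Rightarrow> (real \<Rightarrow> real) \<Rightarrow> bool" where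
  "hartogs_function x0 F \<longleftrightarrow>
     0 < x0 \<and>
     (\<forall>x. 0 \<le> x \<and> ereal x < x0 \<longrightarrow> 0 < F x) \<and>
     antimono_on {x. 0 \<le> x \<and> ereal x < x0} F \<and>
     continuous_on {x. 0 \<le> x \<and> ereal x < x0} F \<and>
     smooth_on {x. 0 < x \<and> ereal x < x0} F"

definition hartogs_domain :: "'n \<Rightarrow> ereal \<Rightarrow> (real \<Rightarrow> real) \<Rightarrow> (complex ^ 'n::finite) set" where
  "hartogs_domain i0 x0 F =
     {z. ereal ((cmod (z $ i0))\<^sup>2) < x0 \<and> (\<Sum>j\<in>UNIV - {i0}. (cmod (z $ j))\<^sup>2) < F ((cmod (z $ i0))\<^sup>2)}"

definition hartogs_potential :: "'n \<Rightarrow> (real \<Rightarrow> real) \<Rightarrow> complex ^ 'n::finite \<Rightarrow> real" where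
  "hartogs_potential i0 F z =
     ln (1 / (F ((cmod (z $ i0))\<^sup>2) - (\<Sum>j\<in>UNIV - {i0}. (cmod (z $ j))\<^sup>2)))"

definition hartogs_metric :: "'n \<Rightarrow> (real \<Rightarrow> real) \<Rightarrow> complex ^ 'n::finite \<Rightarrow> complex ^ 'n ^ 'n" where
  "hartogs_metric i0 F = complex_hessian (\<lambda>z. of_real (hartogs_potential i0 F z))"

text \<open>
  Smoothness of \<open>F(|z\<^sub>0|\<^sup>2)\<close> across \<open>z\<^sub>0 = 0\<close> is stated explicitly: it makes the
  potential smooth on the whole domain, so that the classical derivatives in
  \<open>hartogs_metric\<close> exist everywhere.
\<close>

definition strongly_pseudoconvex_hartogs :: "'n::finite \<Rightarrow> ereal \<Rightarrow> (real \<Rightarrow> real) \<Rightarrow> bool" where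
  "strongly_pseudoconvex_hartogs i0 x0 F \<longleftrightarrow>
     hartogs_function x0 F \<and>
     smooth_on {w :: complex. ereal ((cmod w)\<^sup>2) < x0} (\<lambda>w. F ((cmod w)\<^sup>2)) \<and>
     kahler_metric_on (hartogs_domain i0 x0 F) (hartogs_metric i0 F)"

definition hyperbolic_space :: "'n \<Rightarrow> (complex ^ 'n::finite) set" where
  "hyperbolic_space i0 = hartogs_domain i0 1 (\<lambda>x. 1 - x)"

definition hyperbolic_metric :: "'n \<Rightarrow> complex ^ 'n::finite \<Rightarrow> complex ^ 'n ^ 'n" where
  "hyperbolic_metric i0 = hartogs_metric i0 (\<lambda>x. 1 - x)"

end

theory Submission
  imports Defs
begin

text \<open>
  Why extremality forces hyperbolicity. Write \<open>t = |z\<^sub>0|\<^sup>2\<close>,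
  \<open>A = F t - \<Sum> |z\<^sub>j|\<^sup>2\<close> and \<open>n\<close> for the dimension. The metric has potential \<open>- ln A\<close>, hence is a
  diagonal matrix plus a rank-one matrix, and its determinant is \<open>b t / A^(n+1)\<close> with
  \<open>b = t F'\<^sup>2 - F (F' + t F'')\<close>. The Ricci tensor is therefore \<open>- (n + 1) g\<close> up to a single entry
  depending on \<open>t\<close> only, and the scalar curvature is \<open>- n (n + 1) - A F Q\<close> with
  \<open>Q = (t (ln b)')' / b\<close>.

  The gradient field of this function has components \<open>- A\<^sup>2 T z\<^sub>0\<close> and \<open>- A\<^sup>2 P z\<^sub>k\<close>, where \<open>T\<close> and
  \<open>P\<close> are functions of \<open>t\<close> determined by \<open>F\<close> and \<open>Q\<close> (lemma \<open>scal_field_hartogs_metric\<close>). For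
  \<open>n \<ge> 2\<close> there is a fibre direction, and differentiating \<open>A\<^sup>2\<close> along it gives a nonzero
  antiholomorphic derivative unless \<open>T = P = 0\<close>, which means \<open>Q = 0\<close> (lemma
  \<open>extremal_imp_Q_zero\<close>).

  There remains the ordinary differential equation \<open>(t (ln b)')' = 0\<close> on \<open>0 < t < x0\<close>. It is
  singular at \<open>0\<close>, and among its solutions the regular ones are singled out by positivity of the
  metric at the origin (so \<open>b\<close> has a positive limit) and by smoothness of \<open>F (|z\<^sub>0|\<^sup>2)\<close> there (so
  \<open>t F' t\<close> tends to \<open>0\<close>). These are the decreasing affine functions \<open>F t = F 0 - m t\<close> (lemma
  \<open>hartogs_function_affine\<close>), and a diagonal rescaling of the coordinates carries the metric of
  an affine \<open>F\<close> to the hyperbolic one (lemma \<open>hartogs_affine_isometric_to_hyperbolic\<close>).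
\<close>

section \<open>Wirtinger calculus\<close>

text \<open>
  Recording both Wirtinger gradients in one real derivative turns the computation of
  \<open>d_z\<close> and \<open>d_zbar\<close> into the usual product and chain rules, with differentiability
  carried along.
\<close>
definition has_wirtinger ::
    "(complex ^ 'n::finite \<Rightarrow> complex) \<Rightarrow> ('n \<Rightarrow> complex) \<Rightarrow> ('n \<Rightarrow> complex) \<Rightarrow> complex ^ 'n \<Rightarrow> bool" where
  "has_wirtinger f a b z \<longleftrightarrow>
     (f has_derivative (\<lambda>v. \<Sum>\<alpha>\<in>UNIV. a \<alpha> * v $ \<alpha> + b \<alpha> * cnj (v $ \<alpha>))) (at z)"

lemma has_wirtinger_imp_d_z:
  assumes "has_wirtinger f a b z"
  shows "d_z \<alpha> f z = a \<alpha>" and "d_zbar \<alpha> f z = b \<alpha>"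
proof -
  have D: "frechet_derivative f (at z) =
      (\<lambda>v. \<Sum>\<alpha>\<in>UNIV. a \<alpha> * v $ \<alpha> + b \<alpha> * cnj (v $ \<alpha>))"
    by (rule frechet_derivative_at[symmetric]) (rule assms[unfolded has_wirtinger_def])
  have ax: "(\<Sum>\<beta>\<in>UNIV. a \<beta> * axis \<alpha> c $ \<beta> + b \<beta> * cnj (axis \<alpha> c $ \<beta>)) = a \<alpha> * c + b \<alpha> * cnj c" for c
  proof -
    have "(\<Sum>\<beta>\<in>UNIV. a \<beta> * axis \<alpha> c $ \<beta> + b \<beta> * cnj (axis \<alpha> c $ \<beta>))
        = (\<Sum>\<beta>\<in>UNIV. if \<beta> = \<alpha> then a \<beta> * c + b \<beta> * cnj c else 0)"
      by (rule sum.cong) (auto simp: axis_def)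
    then show ?thesis by simp
  qed
  show "d_z \<alpha> f z = a \<alpha>" "d_zbar \<alpha> f z = b \<alpha>"
    unfolding d_z_def d_zbar_def D ax by (simp_all add: algebra_simps)
qed

lemma has_wirtinger_transform_open:
  assumes "has_wirtinger f a b z" "open S" "z \<in> S" "\<And>w. w \<in> S \<Longrightarrow> f w = h w"
  shows "has_wirtinger h a b z"
  using has_derivative_transform_within_open[OF assms(1)[unfolded has_wirtinger_def] assms(2,3,4)]
  by (simp add: has_wirtinger_def)

lemma has_wirtinger_cong:
  assumes "has_wirtinger f a b z" "\<And>\<alpha>. a \<alpha> = a' \<alpha>" "\<And>\<alpha>. b \<alpha> = b' \<alpha>"
  shows "has_wirtinger f a' b' z"
proof -
  have "a = a'" "b = b'" using assms(2,3) by auto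
  with assms(1) show ?thesis by simp
qed

lemma has_wirtinger_const: "has_wirtinger (\<lambda>z. c) (\<lambda>_. 0) (\<lambda>_. 0) z"
  unfolding has_wirtinger_def by simp

lemma sum_delta_mult:
  "(\<Sum>\<alpha>\<in>(UNIV::'n::finite set). (if \<alpha> = j then c else 0) * (h \<alpha> :: complex)) = c * h j"
proof -
  have "(\<Sum>\<alpha>\<in>(UNIV::'n set). (if \<alpha> = j then c else 0) * h \<alpha>) = (\<Sum>\<alpha>\<in>UNIV. if \<alpha> = j then c * h \<alpha> else 0)"
    by (rule sum.cong) auto
  then show ?thesis by simp
qed

lemma has_wirtinger_nth:
  "has_wirtinger (\<lambda>z. z $ j) (\<lambda>\<alpha>. if \<alpha> = j then 1 else 0) (\<lambda>_. 0) z"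
  unfolding has_wirtinger_def
  by (simp add: sum_delta_mult del: mult_delta_left) (intro bounded_linear_imp_has_derivative bounded_linear_vec_nth)

lemma has_wirtinger_cnj_nth:
  "has_wirtinger (\<lambda>z. cnj (z $ j)) (\<lambda>_. 0) (\<lambda>\<alpha>. if \<alpha> = j then 1 else 0) z"
  unfolding has_wirtinger_def
  by (simp add: sum_delta_mult del: mult_delta_left)
    (intro bounded_linear_imp_has_derivative bounded_linear_compose[OF bounded_linear_cnj bounded_linear_vec_nth])

lemma has_wirtinger_add:
  assumes "has_wirtinger f a b z" "has_wirtinger h a' b' z"
  shows "has_wirtinger (\<lambda>z. f z + h z) (\<lambda>\<alpha>. a \<alpha> + a' \<alpha>) (\<lambda>\<alpha>. b \<alpha> + b' \<alpha>) z"
  using has_derivative_add[OF assms[unfolded has_wirtinger_def]]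
  unfolding has_wirtinger_def by (simp add: sum.distrib[symmetric] algebra_simps)

lemma has_wirtinger_mult:
  assumes "has_wirtinger f a b z" "has_wirtinger h a' b' z"
  shows "has_wirtinger (\<lambda>z. f z * h z)
    (\<lambda>\<alpha>. f z * a' \<alpha> + a \<alpha> * h z) (\<lambda>\<alpha>. f z * b' \<alpha> + b \<alpha> * h z) z"
  using has_derivative_mult[OF assms[unfolded has_wirtinger_def]]
  unfolding has_wirtinger_def
  by (simp add: sum.distrib[symmetric] sum_distrib_left sum_distrib_right algebra_simps)

lemma has_wirtinger_cmult:
  assumes "has_wirtinger f a b z"
  shows "has_wirtinger (\<lambda>z. c * f z) (\<lambda>\<alpha>. c * a \<alpha>) (\<lambda>\<alpha>. c * b \<alpha>) z"
  using has_wirtinger_mult[OF has_wirtinger_const assms] by simp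

lemma has_wirtinger_sum:
  assumes "finite J" "\<And>j. j \<in> J \<Longrightarrow> has_wirtinger (f j) (a j) (b j) z"
  shows "has_wirtinger (\<lambda>z. \<Sum>j\<in>J. f j z) (\<lambda>\<alpha>. \<Sum>j\<in>J. a j \<alpha>) (\<lambda>\<alpha>. \<Sum>j\<in>J. b j \<alpha>) z"
  using assms by (induction J) (auto intro: has_wirtinger_const has_wirtinger_add)

text \<open>
  A real-valued function viewed as complex has a real-valued derivative, so composing with a
  real function multiplies both gradients by the same real number. Every coefficient
  occurring below is built from real functions of \<open>|z\<^sub>0|\<^sup>2\<close> and of the fibre gap, so this
  is the only chain rule that is called for.
\<close>
lemma has_wirtinger_real_compose:
  assumes "(p has_real_derivative p') (at (R z))"
    and "has_wirtinger (\<lambda>z. of_real (R z)) a b z"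
  shows "has_wirtinger (\<lambda>z. of_real (p (R z))) (\<lambda>\<alpha>. of_real p' * a \<alpha>) (\<lambda>\<alpha>. of_real p' * b \<alpha>) z"
proof -
  let ?D = "\<lambda>v. \<Sum>\<alpha>\<in>UNIV. a \<alpha> * v $ \<alpha> + b \<alpha> * cnj (v $ \<alpha>)"
  have D: "((\<lambda>z. complex_of_real (R z)) has_derivative ?D) (at z)"
    using assms(2) by (simp add: has_wirtinger_def)
  have R: "(R has_derivative (\<lambda>v. Re (?D v))) (at z)"
    using bounded_linear.has_derivative[OF bounded_linear_Re D] by simp
  have "((\<lambda>z. complex_of_real (R z)) has_derivative (\<lambda>v. of_real (Re (?D v)))) (at z)"
    by (rule bounded_linear.has_derivative[OF bounded_linear_of_real R])
  from has_derivative_unique[OF this D] have re: "complex_of_real (Re (?D v)) = ?D v" for v by metis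
  have "((\<lambda>z. p (R z)) has_derivative (\<lambda>v. p' * Re (?D v))) (at z)"
    using has_derivative_compose[OF R assms(1)[unfolded has_field_derivative_def]] by simp
  from bounded_linear.has_derivative[OF bounded_linear_of_real[where 'a=complex] this]
  have "((\<lambda>z. complex_of_real (p (R z))) has_derivative (\<lambda>v. of_real p' * ?D v)) (at z)"
    by (simp only: re of_real_mult)
  then show ?thesis
    unfolding has_wirtinger_def by (simp add: sum_distrib_left algebra_simps)
qed

lemma has_wirtinger_cmod_sq:
  "has_wirtinger (\<lambda>z. of_real ((cmod (z $ j))\<^sup>2))
     (\<lambda>\<alpha>. if \<alpha> = j then cnj (z $ j) else 0) (\<lambda>\<alpha>. if \<alpha> = j then z $ j else 0) z"
proof -
  have "has_wirtinger (\<lambda>z. z $ j * cnj (z $ j))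
     (\<lambda>\<alpha>. if \<alpha> = j then cnj (z $ j) else 0) (\<lambda>\<alpha>. if \<alpha> = j then z $ j else 0) z"
    by (rule has_wirtinger_cong[OF has_wirtinger_mult[OF has_wirtinger_nth has_wirtinger_cnj_nth]]) auto
  then show ?thesis by (simp only: complex_norm_square)
qed

section \<open>Determinant and inverse of a matrix\<close>

text \<open>
  In the Leibniz expansion a permutation that contributes must fix every index other than
  \<open>k\<close>, hence also \<open>k\<close>.
\<close>
lemma det_diag_except_row:
  fixes d v :: "'n::finite \<Rightarrow> 'a::field"
  shows "det (\<chi> i j. if i = k then v j else if j = i then d i else 0) = v k * (\<Prod>i\<in>UNIV - {k}. d i)"
proof -
  let ?M = "(\<chi> i j. if i = k then v j else if j = i then d i else 0) :: 'a ^ 'n ^ 'n"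
  have "(\<Prod>i\<in>UNIV. ?M $ i $ p i) = 0" if p: "p permutes UNIV" "p \<noteq> id" for p
  proof -
    have "\<exists>i. i \<noteq> k \<and> p i \<noteq> i"
    proof (rule ccontr)
      assume "\<not> (\<exists>i. i \<noteq> k \<and> p i \<noteq> i)"
      then have fx: "\<And>i. i \<noteq> k \<Longrightarrow> p i = i" by auto
      have "inj p" using p(1) by (simp add: permutes_inj)
      then have "p k = k" using fx by (metis injD)
      with fx have "p = id" by (metis eq_id_iff)
      with p(2) show False by simp
    qed
    then obtain i where "i \<noteq> k" "p i \<noteq> i" by auto
    then have "?M $ i $ p i = 0" by simp
    then show ?thesis by (meson UNIV_I finite prod_zero)
  qed
  then have "det ?M = (\<Sum>p\<in>{id}. of_int (sign p) * (\<Prod>i\<in>UNIV. ?M $ i $ p i))"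
    unfolding det_def by (intro sum.mono_neutral_right) (auto simp: permutes_id)
  also have "\<dots> = (\<Prod>i\<in>UNIV. ?M $ i $ i)" by (simp add: sign_id)
  also have "\<dots> = v k * (\<Prod>i\<in>UNIV - {k}. d i)"
    by (subst prod.remove[of _ k]) auto
  finally show ?thesis .
qed

text \<open>
  The matrix determinant lemma in a division-free form, which is needed because an
  entry of the diagonal part of the Hartogs metric can vanish. The rank-one term is switched on row by row: by
  linearity in the row being switched on, the determinant changes by \<open>u k\<close> times a
  determinant with \<open>v\<close> in row \<open>k\<close>, and subtracting multiples of that row removes the
  rank-one term from all other rows.
\<close>
lemma det_diag_plus_rank_one:
  fixes d u v :: "'n::finite \<Rightarrow> 'a::field"
  shows "det (\<chi> i j. (if j = i then d i else 0) + u i * v j)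
    = (\<Prod>i\<in>UNIV. d i) + (\<Sum>i\<in>UNIV. u i * v i * (\<Prod>j\<in>UNIV - {i}. d j))"
proof -
  define diag where "diag i = (\<chi> j. if j = i then d i else 0)" for i
  define w where "w = (\<chi> j. v j)"
  define M where "M S = (\<chi> i. diag i + (if i \<in> S then u i *s w else 0))" for S
  define N where "N k S = (\<chi> i. if i = k then w else diag i + (if i \<in> S then u i *s w else 0))" for k S
  have N0: "det (N k {}) = v k * (\<Prod>i\<in>UNIV - {k}. d i)" for k
  proof -
    have "N k {} = (\<chi> i j. if i = k then v j else if j = i then d i else 0)"
      by (simp add: N_def vec_eq_iff diag_def w_def)
    then show ?thesis using det_diag_except_row[of k v d] by simp
  qed
  have N: "det (N k S) = det (N k {})" if "finite S" "k \<notin> S" for k S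
    using that
  proof (induction S)
    case (insert a S)
    then have "a \<noteq> k" by auto
    have "N k (insert a S) = (\<chi> i. if i = a then row a (N k S) + u a *s row k (N k S) else row i (N k S))"
      using insert \<open>a \<noteq> k\<close> by (auto simp: N_def vec_eq_iff row_def)
    with det_row_operation[OF \<open>a \<noteq> k\<close>, of "N k S" "u a"] insert show ?case by simp
  qed simp
  have M: "det (M S) = (\<Prod>i\<in>UNIV. d i) + (\<Sum>i\<in>S. u i * v i * (\<Prod>j\<in>UNIV - {i}. d j))"
    if "finite S" for S
    using that
  proof (induction S)
    case empty
    have "det (M {}) = (\<Prod>i\<in>UNIV. M {} $ i $ i)"
      by (rule det_diagonal) (auto simp: M_def diag_def)
    then show ?case by (simp add: M_def diag_def)
  next
    case (insert a S)
    let ?r = "\<lambda>i. diag i + (if i \<in> S then u i *s w else 0)"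
    have "M (insert a S) = (\<chi> i. if i = a then diag a + u a *s w else ?r i)"
      by (auto simp: M_def vec_eq_iff)
    then have "det (M (insert a S)) = det (\<chi> i. if i = a then diag a else ?r i)
        + u a * det (\<chi> i. if i = a then w else ?r i)"
      by (simp only: det_row_add det_row_mul)
    moreover have "(\<chi> i. if i = a then diag a else ?r i) = M S"
      using insert by (auto simp: M_def vec_eq_iff)
    moreover have "(\<chi> i. if i = a then w else ?r i) = N a S"
      by (simp add: N_def)
    ultimately show ?case using insert N[of S a] N0[of a] by (simp add: algebra_simps)
  qed
  have "M UNIV = (\<chi> i j. (if j = i then d i else 0) + u i * v j)"
    by (simp add: M_def vec_eq_iff diag_def w_def)
  with M[of UNIV] show ?thesis by simp
qed

lemma matrix_inv_cancel:
  fixes M :: "'a::semiring_1 ^ 'n ^ 'm"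
  assumes "invertible M"
  shows "M ** matrix_inv M = mat 1" and "matrix_inv M ** M = mat 1"
  using someI_ex[OF assms[unfolded invertible_def]] by (simp_all add: matrix_inv_def)

text \<open>
  Applying an inverse matrix amounts to guessing the solution of a linear system; this avoids
  computing cofactors of the metric.
\<close>
lemma sum_matrix_inv_eq:
  fixes M :: "'a::field ^ 'n ^ 'n::finite"
  assumes "invertible M" "\<And>\<gamma>. (\<Sum>\<alpha>\<in>UNIV. V \<alpha> * M $ \<alpha> $ \<gamma>) = d \<gamma>"
  shows "(\<Sum>\<beta>\<in>UNIV. matrix_inv M $ \<beta> $ \<alpha> * d \<beta>) = V \<alpha>"
proof -
  have "(\<Sum>\<beta>\<in>UNIV. matrix_inv M $ \<beta> $ \<alpha> * d \<beta>)
      = (\<Sum>\<beta>\<in>UNIV. \<Sum>\<alpha>'\<in>UNIV. V \<alpha>' * (M $ \<alpha>' $ \<beta> * matrix_inv M $ \<beta> $ \<alpha>))"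
    by (simp add: assms(2)[symmetric] sum_distrib_left algebra_simps)
  also have "\<dots> = (\<Sum>\<alpha>'\<in>UNIV. V \<alpha>' * (M ** matrix_inv M) $ \<alpha>' $ \<alpha>)"
    by (subst sum.swap) (simp add: matrix_matrix_mult_def sum_distrib_left)
  also have "\<dots> = (\<Sum>\<alpha>'\<in>UNIV. if \<alpha>' = \<alpha> then V \<alpha>' else 0)"
    using matrix_inv_cancel(1)[OF assms(1)] by (intro sum.cong) (auto simp: mat_def)
  finally show ?thesis by simp
qed

section \<open>The metric of a Hartogs domain\<close>

text \<open>
  The quantity \<open>A\<close> for which the Kaehler potential is \<open>- ln A\<close>; it is positive exactly
  inside the fibre.
\<close>
definition fibre_gap :: "'n::finite \<Rightarrow> (real \<Rightarrow> real) \<Rightarrow> complex ^ 'n \<Rightarrow> real" where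
  "fibre_gap i0 F z = F ((cmod (z $ i0))\<^sup>2) - (\<Sum>j\<in>UNIV - {i0}. (cmod (z $ j))\<^sup>2)"

lemma has_wirtinger_radial:
  assumes "(p has_real_derivative p') (at ((cmod (z $ i0))\<^sup>2))"
  shows "has_wirtinger (\<lambda>z. of_real (p ((cmod (z $ i0))\<^sup>2)))
     (\<lambda>\<alpha>. if \<alpha> = i0 then of_real p' * cnj (z $ i0) else 0)
     (\<lambda>\<alpha>. if \<alpha> = i0 then of_real p' * z $ i0 else 0) z"
  by (rule has_wirtinger_cong
      [OF has_wirtinger_real_compose[where R = "\<lambda>z. (cmod (z $ i0))\<^sup>2", OF assms has_wirtinger_cmod_sq]]) auto

text \<open>
  An open set on which the Hartogs potential of \<open>F\<close> can be differentiated twice. It need not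
  be the whole Hartogs domain: \<open>F\<close> may fail to be differentiable at \<open>0\<close>, so for a general
  \<open>F\<close> the hyperplane \<open>z\<^sub>0 = 0\<close> is removed, while an affine \<open>F\<close> allows the full domain.
\<close>
locale hartogs_region =
  fixes i0 :: "'n::finite" and F F1 F2 :: "real \<Rightarrow> real" and S :: "(complex ^ 'n) set"
  assumes open_S: "open S"
    and gap_pos: "z \<in> S \<Longrightarrow> 0 < fibre_gap i0 F z"
    and DF: "z \<in> S \<Longrightarrow> (F has_real_derivative F1 ((cmod (z $ i0))\<^sup>2)) (at ((cmod (z $ i0))\<^sup>2))"
    and DF1: "z \<in> S \<Longrightarrow> (F1 has_real_derivative F2 ((cmod (z $ i0))\<^sup>2)) (at ((cmod (z $ i0))\<^sup>2))"
begin

abbreviation x where "x z \<equiv> (cmod (z $ i0))\<^sup>2"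
abbreviation A where "A \<equiv> fibre_gap i0 F"

text \<open>
  With \<open>A = fibre_gap i0 F\<close>, the gradients of \<open>A\<close> are
  \<open>gap_grad \<alpha>\<close> times \<open>cnj z\<^sub>\<alpha>\<close> and \<open>z\<^sub>\<alpha>\<close>, its complex Hessian is the diagonal matrix with
  entries \<open>gap_hess \<alpha>\<close>, and \<open>det_num\<close> is the numerator of the determinant of the metric. In
  terms of the logarithm of \<open>F\<close>, \<open>det_num t = - F\<^sup>2 (t F' / F)'\<close>.
\<close>
definition gap_grad :: "'n \<Rightarrow> real \<Rightarrow> real" where
  "gap_grad \<alpha> t = (if \<alpha> = i0 then F1 t else - 1)"

definition gap_hess :: "'n \<Rightarrow> real \<Rightarrow> real" where
  "gap_hess \<alpha> t = (if \<alpha> = i0 then F1 t + t * F2 t else - 1)"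

definition det_num :: "real \<Rightarrow> real" where
  "det_num t = t * (F1 t)\<^sup>2 - F t * (F1 t + t * F2 t)"

lemma gap_grad_simps [simp]: "gap_grad i0 t = F1 t" "\<alpha> \<noteq> i0 \<Longrightarrow> gap_grad \<alpha> t = - 1"
  by (auto simp: gap_grad_def)

lemma gap_hess_simps [simp]: "gap_hess i0 t = F1 t + t * F2 t" "\<alpha> \<noteq> i0 \<Longrightarrow> gap_hess \<alpha> t = - 1"
  by (auto simp: gap_hess_def)

lemma F_eq: "F (x z) = A z + (\<Sum>j\<in>UNIV - {i0}. (cmod (z $ j))\<^sup>2)"
  by (simp add: fibre_gap_def)

lemma F_pos: "z \<in> S \<Longrightarrow> 0 < F (x z)"
  using gap_pos[of z] unfolding F_eq by (simp add: add_pos_nonneg sum_nonneg)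

lemma has_wirtinger_gap:
  assumes "z \<in> S"
  shows "has_wirtinger (\<lambda>z. of_real (A z))
    (\<lambda>\<alpha>. of_real (gap_grad \<alpha> (x z)) * cnj (z $ \<alpha>)) (\<lambda>\<alpha>. of_real (gap_grad \<alpha> (x z)) * z $ \<alpha>) z"
proof -
  have "has_wirtinger (\<lambda>z. of_real (F (x z)) + (- 1) * (\<Sum>j\<in>UNIV - {i0}. of_real ((cmod (z $ j))\<^sup>2)))
    (\<lambda>\<alpha>. of_real (gap_grad \<alpha> (x z)) * cnj (z $ \<alpha>)) (\<lambda>\<alpha>. of_real (gap_grad \<alpha> (x z)) * z $ \<alpha>) z"
    by (rule has_wirtinger_cong[OF has_wirtinger_add[OF has_wirtinger_radial[OF DF[OF assms]]
            has_wirtinger_cmult[OF has_wirtinger_sum[OF _ has_wirtinger_cmod_sq]]]])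
      (auto simp: gap_grad_def)
  then show ?thesis
    by (simp add: fibre_gap_def)
qed

lemma has_wirtinger_gap_compose:
  assumes "z \<in> S" "(p has_real_derivative p') (at (A z))"
  shows "has_wirtinger (\<lambda>z. of_real (p (A z)))
    (\<lambda>\<alpha>. of_real (p' * gap_grad \<alpha> (x z)) * cnj (z $ \<alpha>)) (\<lambda>\<alpha>. of_real (p' * gap_grad \<alpha> (x z)) * z $ \<alpha>) z"
  by (rule has_wirtinger_cong[OF has_wirtinger_real_compose[where R = A, OF assms(2) has_wirtinger_gap[OF assms(1)]]])
    auto

lemma has_wirtinger_potential:
  assumes "z \<in> S"
  shows "has_wirtinger (\<lambda>z. of_real (hartogs_potential i0 F z))
    (\<lambda>\<alpha>. of_real (- (gap_grad \<alpha> (x z) / A z)) * cnj (z $ \<alpha>)) (\<lambda>\<alpha>. of_real (- (gap_grad \<alpha> (x z) / A z)) * z $ \<alpha>) z"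
proof -
  have "((\<lambda>t. ln (1 / t)) has_real_derivative - 1 / A z) (at (A z))"
    using gap_pos[OF assms] by (auto intro!: derivative_eq_intros simp: field_simps)
  from has_wirtinger_gap_compose[OF assms this] show ?thesis
    by (simp add: hartogs_potential_def fibre_gap_def)
qed

lemma has_wirtinger_d_zbar_potential:
  assumes "z \<in> S"
  obtains c where "has_wirtinger (d_zbar \<beta> (\<lambda>z. of_real (hartogs_potential i0 F z)))
    (\<lambda>\<alpha>. of_real (gap_grad \<alpha> (x z) * gap_grad \<beta> (x z) / (A z)\<^sup>2) * cnj (z $ \<alpha>) * z $ \<beta>
        - (if \<alpha> = \<beta> then of_real (gap_hess \<beta> (x z) / A z) else 0)) c z"
proof -
  define F2' where "F2' = (\<lambda>t. if \<beta> = i0 then F2 t else 0)"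
  have De: "(gap_grad \<beta> has_real_derivative F2' (x z)) (at (x z))"
  proof -
    have "gap_grad \<beta> = (if \<beta> = i0 then F1 else (\<lambda>_. - 1))"
      by (auto simp: gap_grad_def fun_eq_iff)
    then show ?thesis using DF1[OF assms] by (auto simp: F2'_def)
  qed
  have DA: "((\<lambda>t. - inverse t) has_real_derivative 1 / (A z)\<^sup>2) (at (A z))"
    using gap_pos[OF assms] by (auto intro!: derivative_eq_intros simp: power2_eq_square field_simps)
  note W = has_wirtinger_mult[OF has_wirtinger_mult[OF has_wirtinger_gap_compose[OF assms DA]
        has_wirtinger_radial[OF De]] has_wirtinger_nth[of \<beta>]]
  have D: "d_zbar \<beta> (\<lambda>z. of_real (hartogs_potential i0 F z)) w
      = of_real (- inverse (A w)) * of_real (gap_grad \<beta> (x w)) * w $ \<beta>" if "w \<in> S" for w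
    using has_wirtinger_imp_d_z(2)[OF has_wirtinger_potential[OF that]] by (simp add: field_simps)
  have W': "has_wirtinger (d_zbar \<beta> (\<lambda>z. of_real (hartogs_potential i0 F z)))
    (\<lambda>\<alpha>. of_real (gap_grad \<alpha> (x z) * gap_grad \<beta> (x z) / (A z)\<^sup>2) * cnj (z $ \<alpha>) * z $ \<beta>
        - (if \<alpha> = \<beta> then of_real (gap_hess \<beta> (x z) / A z) else 0)) c z"
    if "has_wirtinger (\<lambda>w. of_real (- inverse (A w)) * of_real (gap_grad \<beta> (x w)) * w $ \<beta>) a c z"
      "\<And>\<alpha>. a \<alpha> = of_real (gap_grad \<alpha> (x z) * gap_grad \<beta> (x z) / (A z)\<^sup>2) * cnj (z $ \<alpha>) * z $ \<beta>
        - (if \<alpha> = \<beta> then of_real (gap_hess \<beta> (x z) / A z) else 0)" for a c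
    using has_wirtinger_transform_open[OF has_wirtinger_cong[OF that refl] open_S assms D[symmetric]] .
  show ?thesis
    by (rule that, rule W', rule W) (use gap_pos[OF assms] in
      \<open>auto simp: field_simps F2'_def complex_norm_square[symmetric] simp del: of_real_power\<close>)
qed

text \<open>
  This is \<open>\<partial>\<partial>bar (- ln A) = A\<^sub>\<alpha> A\<^sub>\<beta>bar / A\<^sup>2 - A\<^sub>\<alpha>\<^sub>\<beta>bar / A\<close>: a diagonal matrix plus a rank-one
  matrix.
\<close>
lemma hartogs_metric_nth:
  assumes "z \<in> S"
  shows "hartogs_metric i0 F z $ \<alpha> $ \<beta> =
    of_real (gap_grad \<alpha> (x z) * gap_grad \<beta> (x z) / (A z)\<^sup>2) * cnj (z $ \<alpha>) * z $ \<beta>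
        - (if \<alpha> = \<beta> then of_real (gap_hess \<beta> (x z) / A z) else 0)"
proof -
  obtain c where "has_wirtinger (d_zbar \<beta> (\<lambda>z. of_real (hartogs_potential i0 F z)))
    (\<lambda>\<alpha>. of_real (gap_grad \<alpha> (x z) * gap_grad \<beta> (x z) / (A z)\<^sup>2) * cnj (z $ \<alpha>) * z $ \<beta>
        - (if \<alpha> = \<beta> then of_real (gap_hess \<beta> (x z) / A z) else 0)) c z"
    using has_wirtinger_d_zbar_potential[OF assms] .
  from has_wirtinger_imp_d_z(1)[OF this] show ?thesis
    by (simp add: hartogs_metric_def complex_hessian_def)
qed

text \<open>
  In the diagonal part all entries but the one at \<open>i0\<close> are \<open>1 / A\<close>, and the squared norms of the fibre coordinates add
  up to \<open>F - A\<close>; the determinant therefore depends on the fibre only through a power of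
  \<open>A\<close>. This is what makes the scalar curvature computable.
\<close>
lemma det_hartogs_metric:
  assumes "z \<in> S"
  shows "det (hartogs_metric i0 F z) = of_real (det_num (x z) / A z ^ (CARD('n) + 1))"
proof -
  define d where "d \<alpha> = - gap_hess \<alpha> (x z) / A z" for \<alpha>
  define D where "D \<alpha> = complex_of_real (d \<alpha>)" for \<alpha>
  define u where "u \<alpha> = of_real (gap_grad \<alpha> (x z) / A z) * cnj (z $ \<alpha>)" for \<alpha>
  define v where "v \<alpha> = of_real (gap_grad \<alpha> (x z) / A z) * z $ \<alpha>" for \<alpha>
  have A: "A z > 0" using gap_pos[OF assms] .
  have di: "d i = 1 / A z" if "i \<noteq> i0" for i using that by (simp add: d_def)
  define m where "m = card (UNIV - {i0})"
  have m: "CARD('n) = Suc m"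
    unfolding m_def by (rule card.remove) auto
  have p0: "(\<Prod>i\<in>UNIV - {i0}. d i) = (1 / A z) ^ m"
    using di by (simp add: m_def)
  have p1: "(\<Prod>i\<in>UNIV. d i) = d i0 * (1 / A z) ^ m"
    using p0 by (subst prod.remove[of _ i0]) auto
  have p2: "(\<Prod>j\<in>UNIV - {i}. d j) = d i0 * (1 / A z) ^ m * A z" if "i \<noteq> i0" for i
  proof -
    have "(\<Prod>j\<in>UNIV. d j) = 1 / A z * (\<Prod>j\<in>UNIV - {i}. d j)"
      using di[OF that] by (subst prod.remove[of _ i]) auto
    then show ?thesis using A p1 by (simp add: field_simps)
  qed
  have uv: "u i * v i = of_real ((gap_grad i (x z))\<^sup>2 * (cmod (z $ i))\<^sup>2 / (A z)\<^sup>2)" for i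
    unfolding u_def v_def
    by (simp only: of_real_mult of_real_divide complex_norm_square) (simp add: power2_eq_square)
  have "hartogs_metric i0 F z = (\<chi> i j. (if j = i then D i else 0) + u i * v j)"
    using A by (auto simp: vec_eq_iff hartogs_metric_nth[OF assms] D_def d_def u_def v_def field_simps power2_eq_square)
  then have "det (hartogs_metric i0 F z)
      = (\<Prod>i\<in>UNIV. D i) + (\<Sum>i\<in>UNIV. u i * v i * (\<Prod>j\<in>UNIV - {i}. D j))"
    by (simp only: det_diag_plus_rank_one)
  also have "\<dots> = of_real ((\<Prod>i\<in>UNIV. d i) +
      (\<Sum>i\<in>UNIV. (gap_grad i (x z))\<^sup>2 * (cmod (z $ i))\<^sup>2 / (A z)\<^sup>2 * (\<Prod>j\<in>UNIV - {i}. d j)))"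
    unfolding uv D_def by simp
  also have "(\<Sum>i\<in>UNIV. (gap_grad i (x z))\<^sup>2 * (cmod (z $ i))\<^sup>2 / (A z)\<^sup>2 * (\<Prod>j\<in>UNIV - {i}. d j))
     = (F1 (x z))\<^sup>2 * x z / (A z)\<^sup>2 * (1 / A z) ^ m
       + (\<Sum>i\<in>UNIV - {i0}. (cmod (z $ i))\<^sup>2 * (1 / (A z)\<^sup>2 * (d i0 * (1 / A z) ^ m * A z)))"
    by (subst sum.remove[of _ i0]) (auto simp: p0 p2 intro!: sum.cong)
  also have "\<dots> = (F1 (x z))\<^sup>2 * x z / (A z)\<^sup>2 * (1 / A z) ^ m
       + (F (x z) - A z) * (1 / (A z)\<^sup>2 * (d i0 * (1 / A z) ^ m * A z))"
    unfolding sum_distrib_right[symmetric] by (simp add: F_eq)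
  also have "(\<Prod>i\<in>UNIV. d i) + \<dots> = det_num (x z) / A z ^ (CARD('n) + 1)"
    unfolding p1 m using A
    by (simp add: d_def det_num_def field_simps power2_eq_square)
  finally show ?thesis .
qed

lemma sum_mult_hartogs_metric:
  assumes "z \<in> S"
  shows "(\<Sum>\<alpha>\<in>UNIV. V \<alpha> * hartogs_metric i0 F z $ \<alpha> $ \<gamma>)
    = (\<Sum>\<alpha>\<in>UNIV. V \<alpha> * of_real (gap_grad \<alpha> (x z)) * cnj (z $ \<alpha>)) * (of_real (gap_grad \<gamma> (x z) / (A z)\<^sup>2) * z $ \<gamma>)
      - V \<gamma> * of_real (gap_hess \<gamma> (x z) / A z)"
proof -
  have "(\<Sum>\<alpha>\<in>UNIV. V \<alpha> * hartogs_metric i0 F z $ \<alpha> $ \<gamma>)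
    = (\<Sum>\<alpha>\<in>UNIV. V \<alpha> * of_real (gap_grad \<alpha> (x z)) * cnj (z $ \<alpha>) * (of_real (gap_grad \<gamma> (x z) / (A z)\<^sup>2) * z $ \<gamma>)
      - (if \<alpha> = \<gamma> then V \<alpha> * of_real (gap_hess \<gamma> (x z) / A z) else 0))"
    by (rule sum.cong) (auto simp: hartogs_metric_nth[OF assms] algebra_simps)
  then show ?thesis
    unfolding sum_subtractf sum_distrib_right by simp
qed

lemma sum_split_i0: "(\<Sum>\<alpha>\<in>UNIV. V \<alpha>) = V i0 + (\<Sum>\<alpha>\<in>UNIV - {i0}. V \<alpha>)" for V :: "'n \<Rightarrow> complex"
  by (rule sum.remove) auto

lemma sum_cmod_sq: "(\<Sum>j\<in>UNIV - {i0}. z $ j * cnj (z $ j)) = of_real (F (x z) - A z)"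
  by (simp add: F_eq complex_norm_square[symmetric])

text \<open>
  Only the entry at \<open>i0\<close> of the inverse enters the scalar curvature, because the Ricci tensor
  differs from a multiple of the metric in that entry alone. The vector \<open>V\<close> in the proof is the
  full row of the inverse, found by solving the fibre equations for multiples of \<open>z\<^sub>k\<close>.
\<close>
lemma matrix_inv_hartogs_metric:
  assumes "z \<in> S" "0 < det_num (x z)"
  shows "invertible (hartogs_metric i0 F z)"
    and "matrix_inv (hartogs_metric i0 F z) $ i0 $ i0 = of_real (A z * F (x z) / det_num (x z))"
proof -
  have A: "A z > 0" using gap_pos[OF assms(1)] .
  show inv: "invertible (hartogs_metric i0 F z)"
    using A assms by (simp add: invertible_det_nz det_hartogs_metric)
  define V where "V \<alpha> = (if \<alpha> = i0 then of_real (A z * F (x z) / det_num (x z))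
      else of_real (A z * F1 (x z) / det_num (x z)) * cnj (z $ i0) * z $ \<alpha>)" for \<alpha>
  have sm: "(\<Sum>\<alpha>\<in>UNIV. V \<alpha> * of_real (gap_grad \<alpha> (x z)) * cnj (z $ \<alpha>))
     = of_real ((A z)\<^sup>2 * F1 (x z) / det_num (x z)) * cnj (z $ i0)"
  proof -
    have "(\<Sum>\<alpha>\<in>UNIV - {i0}. V \<alpha> * of_real (gap_grad \<alpha> (x z)) * cnj (z $ \<alpha>))
      = (\<Sum>\<alpha>\<in>UNIV - {i0}. - (of_real (A z * F1 (x z) / det_num (x z)) * cnj (z $ i0)) * (z $ \<alpha> * cnj (z $ \<alpha>)))"
      by (rule sum.cong) (auto simp: V_def algebra_simps)
    also have "\<dots> = - (of_real (A z * F1 (x z) / det_num (x z)) * cnj (z $ i0)) * of_real (F (x z) - A z)"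
      unfolding sum_distrib_left[symmetric] sum_cmod_sq ..
    finally show ?thesis
      unfolding sum_split_i0 using assms(2)
      by (simp add: V_def field_simps power2_eq_square)
  qed
  have "(\<Sum>\<alpha>\<in>UNIV. V \<alpha> * hartogs_metric i0 F z $ \<alpha> $ \<gamma>) = (if \<gamma> = i0 then 1 else 0)" for \<gamma>
  proof (cases "\<gamma> = i0")
    case True
    define R where "R = (A z)\<^sup>2 * F1 (x z) / det_num (x z) * x z * (F1 (x z) / (A z)\<^sup>2)"
    define a where "a = A z * F (x z) / det_num (x z)"
    define c where "c = (F1 (x z) + x z * F2 (x z)) / A z"
    have R: "of_real ((A z)\<^sup>2 * F1 (x z) / det_num (x z)) * cnj (z $ i0) * (of_real (F1 (x z) / (A z)\<^sup>2) * z $ i0)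
       = complex_of_real R"
      unfolding R_def by (simp only: of_real_mult complex_norm_square mult_ac)
    have "R - a * c = (x z * (F1 (x z))\<^sup>2 - F (x z) * (F1 (x z) + x z * F2 (x z))) / det_num (x z)"
      using A assms(2) unfolding R_def a_def c_def by (simp add: field_simps power2_eq_square)
    then have Rac: "R - a * c = 1"
      using assms(2) by (simp only: det_num_def[symmetric]) simp
    have "V i0 = of_real a"
      by (simp add: V_def a_def)
    then have "(\<Sum>\<alpha>\<in>UNIV. V \<alpha> * hartogs_metric i0 F z $ \<alpha> $ \<gamma>) = of_real R - of_real a * of_real c"
      unfolding sum_mult_hartogs_metric[OF assms(1)] sm True gap_grad_simps gap_hess_simps R by (simp add: c_def)
    also have "\<dots> = of_real (R - a * c)"
      by simp
    finally show ?thesis using Rac True by simp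
  next
    case False
    then show ?thesis
      unfolding sum_mult_hartogs_metric[OF assms(1)] sm using A
      by (simp add: V_def field_simps power2_eq_square)
  qed
  from sum_matrix_inv_eq[OF inv this, of i0]
  have "(\<Sum>\<beta>\<in>UNIV. matrix_inv (hartogs_metric i0 F z) $ \<beta> $ i0 * (if \<beta> = i0 then 1 else 0)) = V i0" .
  then show "matrix_inv (hartogs_metric i0 F z) $ i0 $ i0 = of_real (A z * F (x z) / det_num (x z))"
    by (simp add: V_def if_distrib cong: if_cong)
qed

end

section \<open>Scalar curvature and its gradient field\<close>

text \<open>
  With \<open>L = ln det_num\<close>, the function \<open>Q = (t L')' / det_num\<close> measures the deviation from
  constant scalar curvature, which is \<open>- n (n + 1) - A F Q\<close>. The components of the gradient
  field of the scalar curvature turn out to be \<open>- A\<^sup>2 T z\<^sub>0\<close> along the base and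
  \<open>- A\<^sup>2 P z\<^sub>k\<close> along the fibre, where \<open>T = (F\<^sup>2 Q)' / det_num\<close> and \<open>P = T F' t / F - Q\<close>.
  The equations are assumed with denominators cleared because they are used as
  polynomial identities.
\<close>
locale hartogs_curvature = hartogs_region +
  fixes L1 L2 Q Q1 T T1 P P1 :: "real \<Rightarrow> real"
  assumes det_num_pos: "z \<in> S \<Longrightarrow> 0 < det_num (x z)"
    and DL: "z \<in> S \<Longrightarrow> ((\<lambda>t. ln (det_num t)) has_real_derivative L1 (x z)) (at (x z))"
    and DL1: "z \<in> S \<Longrightarrow> (L1 has_real_derivative L2 (x z)) (at (x z))"
    and Q_eq: "z \<in> S \<Longrightarrow> Q (x z) * det_num (x z) = L1 (x z) + x z * L2 (x z)"
    and DQ: "z \<in> S \<Longrightarrow> (Q has_real_derivative Q1 (x z)) (at (x z))"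
    and T_eq: "z \<in> S \<Longrightarrow> T (x z) * det_num (x z) = 2 * F (x z) * F1 (x z) * Q (x z) + (F (x z))\<^sup>2 * Q1 (x z)"
    and DT: "z \<in> S \<Longrightarrow> (T has_real_derivative T1 (x z)) (at (x z))"
    and P_eq: "z \<in> S \<Longrightarrow> P (x z) * F (x z) = T (x z) * F1 (x z) * x z - Q (x z) * F (x z)"
    and DP: "z \<in> S \<Longrightarrow> (P has_real_derivative P1 (x z)) (at (x z))"
begin

abbreviation g where "g \<equiv> hartogs_metric i0 F"

lemma ln_det_hartogs_metric:
  assumes "z \<in> S"
  shows "ln (det (g z)) = of_real (ln (det_num (x z))) + of_nat (CARD('a) + 1) * of_real (hartogs_potential i0 F z)"
proof -
  have A: "A z > 0" using gap_pos[OF assms] .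
  have "ln (det_num (x z) / A z ^ (CARD('a) + 1)) = ln (det_num (x z)) - (CARD('a) + 1) * ln (A z)"
    using A det_num_pos[OF assms] by (simp add: ln_div ln_mult ln_realpow algebra_simps)
  moreover have "hartogs_potential i0 F z = - ln (A z)"
    using A by (simp add: hartogs_potential_def fibre_gap_def[symmetric] ln_div)
  moreover have "ln (det (g z)) = of_real (ln (det_num (x z) / A z ^ (CARD('a) + 1)))"
    unfolding det_hartogs_metric[OF assms] using A det_num_pos[OF assms] by (intro Ln_of_real) simp
  ultimately show ?thesis by simp
qed

text \<open>
  The logarithm of the determinant is \<open>n + 1\<close> times the potential plus the radial function
  \<open>L\<close>; the Hessian of the latter is concentrated in the entry at \<open>i0\<close>, where it is
  \<open>L' + t L'' = Q det_num\<close>.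
\<close>
lemma ricci_hartogs_metric:
  assumes "z \<in> S"
  shows "ricci g z $ \<alpha> $ \<beta> = - of_nat (CARD('a) + 1) * g z $ \<alpha> $ \<beta>
    - (if \<alpha> = i0 \<and> \<beta> = i0 then of_real (Q (x z) * det_num (x z)) else 0)"
proof -
  let ?\<phi> = "\<lambda>z. complex_of_real (hartogs_potential i0 F z)"
  let ?N = "of_nat (CARD('a) + 1) :: complex"
  define r where "r w = (if \<beta> = i0 then of_real (L1 (x w)) * w $ i0 else 0)" for w
  have D: "?N * d_zbar \<beta> ?\<phi> w + r w = d_zbar \<beta> (\<lambda>w. ln (det (g w))) w" if w: "w \<in> S" for w
  proof -
    note W = has_wirtinger_add[OF has_wirtinger_radial[OF DL[OF w]] has_wirtinger_cmult[OF has_wirtinger_potential[OF w], of ?N]]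
    have "d_zbar \<beta> (\<lambda>w. ln (det (g w))) w
       = (if \<beta> = i0 then of_real (L1 (x w)) * w $ i0 else 0) + ?N * (of_real (- (gap_grad \<beta> (x w) / A w)) * w $ \<beta>)"
      by (rule has_wirtinger_imp_d_z(2)[OF has_wirtinger_transform_open[OF W open_S w]])
        (simp add: ln_det_hartogs_metric)
    then show ?thesis
      using has_wirtinger_imp_d_z(2)[OF has_wirtinger_potential[OF w]] by (simp add: r_def)
  qed
  obtain c where C: "has_wirtinger (d_zbar \<beta> ?\<phi>) (\<lambda>\<alpha>. g z $ \<alpha> $ \<beta>) c z"
    using has_wirtinger_d_zbar_potential[OF assms] unfolding hartogs_metric_nth[OF assms, symmetric] .
  have "\<exists>c'. has_wirtinger r (\<lambda>\<alpha>. if \<alpha> = i0 \<and> \<beta> = i0 then of_real (Q (x z) * det_num (x z)) else 0) c' z"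
  proof (cases "\<beta> = i0")
    case True
    have sq: "cnj (z $ i0) * z $ i0 = of_real (x z)"
      by (simp only: complex_norm_square mult.commute)
    have "has_wirtinger (\<lambda>w. of_real (L1 (x w)) * w $ i0)
       (\<lambda>\<alpha>. if \<alpha> = i0 then of_real (Q (x z) * det_num (x z)) else 0)
       (\<lambda>\<alpha>. of_real (L1 (x z)) * 0 + (if \<alpha> = i0 then of_real (L2 (x z)) * z $ i0 else 0) * z $ i0) z"
      by (rule has_wirtinger_cong[OF has_wirtinger_mult
         [OF has_wirtinger_radial[OF DL1[OF assms]] has_wirtinger_nth[of i0]]])
        (auto simp: Q_eq[OF assms] mult.assoc sq simp del: of_real_power)
    then have "\<exists>c'. has_wirtinger r (\<lambda>\<alpha>. if \<alpha> = i0 then of_real (Q (x z) * det_num (x z)) else 0) c' z"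
      unfolding r_def[abs_def] True by auto
    then show ?thesis using True by simp
  next
    case False
    then show ?thesis
      using has_wirtinger_const[of 0 z] by (auto simp: r_def[abs_def])
  qed
  then obtain c' where C': "has_wirtinger r (\<lambda>\<alpha>. if \<alpha> = i0 \<and> \<beta> = i0 then of_real (Q (x z) * det_num (x z)) else 0) c' z"
    by blast
  have "d_z \<alpha> (d_zbar \<beta> (\<lambda>w. ln (det (g w)))) z = ?N * g z $ \<alpha> $ \<beta>
     + (if \<alpha> = i0 \<and> \<beta> = i0 then of_real (Q (x z) * det_num (x z)) else 0)"
    by (rule has_wirtinger_imp_d_z(1)[OF has_wirtinger_transform_open
          [OF has_wirtinger_add[OF has_wirtinger_cmult[OF C, of ?N] C'] open_S assms D]])
  then show ?thesis
    by (simp add: ricci_def complex_hessian_def algebra_simps)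
qed

lemma scal_hartogs_metric:
  assumes "z \<in> S"
  shows "scal g z = - of_nat (CARD('a) * (CARD('a) + 1)) - of_real (A z * (F (x z) * Q (x z)))"
proof -
  let ?N = "of_nat (CARD('a) + 1) :: complex"
  let ?I = "matrix_inv (g z)"
  have det_num: "det_num (x z) > 0" using det_num_pos[OF assms] .
  note inv = matrix_inv_hartogs_metric[OF assms det_num]
  have tr: "(\<Sum>\<alpha>\<in>UNIV. \<Sum>\<beta>\<in>UNIV. ?I $ \<beta> $ \<alpha> * g z $ \<alpha> $ \<beta>) = of_nat CARD('a)"
  proof -
    have "(\<Sum>\<alpha>\<in>UNIV. \<Sum>\<beta>\<in>UNIV. ?I $ \<beta> $ \<alpha> * g z $ \<alpha> $ \<beta>) = (\<Sum>\<beta>\<in>UNIV. (?I ** g z) $ \<beta> $ \<beta>)"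
      by (subst sum.swap) (simp add: matrix_matrix_mult_def)
    then show ?thesis by (simp add: matrix_inv_cancel(2)[OF inv(1)] mat_def)
  qed
  have "scal g z = (\<Sum>\<alpha>\<in>UNIV. \<Sum>\<beta>\<in>UNIV. - ?N * (?I $ \<beta> $ \<alpha> * g z $ \<alpha> $ \<beta>)
     - (if \<beta> = i0 then (if \<alpha> = i0 then ?I $ i0 $ i0 * of_real (Q (x z) * det_num (x z)) else 0) else 0))"
    unfolding scal_def ricci_hartogs_metric[OF assms] by (intro sum.cong) (auto simp: algebra_simps)
  also have "\<dots> = - ?N * of_nat CARD('a) - ?I $ i0 $ i0 * of_real (Q (x z) * det_num (x z))"
    unfolding sum_subtractf sum_distrib_left[symmetric] tr by simp
  also have "?I $ i0 $ i0 * of_real (Q (x z) * det_num (x z)) = of_real (A z * (F (x z) * Q (x z)))"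
    unfolding inv(2) using det_num by simp
  finally show ?thesis by (simp add: algebra_simps)
qed

lemma d_zbar_scal:
  assumes "z \<in> S"
  shows "d_zbar \<gamma> (scal g) z = - (of_real (gap_grad \<gamma> (x z) * (F (x z) * Q (x z))
     + (if \<gamma> = i0 then A z * (F1 (x z) * Q (x z) + F (x z) * Q1 (x z)) else 0)) * z $ \<gamma>)"
proof -
  have "((\<lambda>t. F t * Q t) has_real_derivative F1 (x z) * Q (x z) + F (x z) * Q1 (x z)) (at (x z))"
    using DF[OF assms] DQ[OF assms] by (auto intro!: derivative_eq_intros)
  note W = has_wirtinger_add[OF has_wirtinger_const has_wirtinger_cmult[OF
        has_wirtinger_mult[OF has_wirtinger_gap[OF assms] has_wirtinger_radial[OF this]]],
      of "- of_nat (CARD('a) * (CARD('a) + 1))" "- 1"]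
  show ?thesis
    by (rule trans[OF has_wirtinger_imp_d_z(2)[OF has_wirtinger_transform_open[OF W open_S assms]]])
      (auto simp: scal_hartogs_metric algebra_simps)
qed

definition scal_coeff :: "'a \<Rightarrow> real \<Rightarrow> real" where
  "scal_coeff \<alpha> t = (if \<alpha> = i0 then T t else P t)"

lemma scal_coeff_simps [simp]: "scal_coeff i0 t = T t" "\<alpha> \<noteq> i0 \<Longrightarrow> scal_coeff \<alpha> t = P t"
  by (auto simp: scal_coeff_def)

text \<open>
  The stated vector \<open>V\<close> solves \<open>\<Sum> V\<^sub>\<alpha> g\<^sub>\<alpha>\<^sub>\<gamma>bar = \<partial> scal / \<partial>zbar\<^sub>\<gamma>\<close>. Since the metric is diagonal
  plus rank one, both sides are real multiples of \<open>z\<^sub>\<gamma>\<close>, and the identity \<open>key\<close> compares these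
  multiples: the fibre components give the equation defining \<open>P\<close>, the base component the one
  defining \<open>T\<close>.
\<close>
lemma scal_field_hartogs_metric:
  assumes "z \<in> S"
  shows "scal_field g \<alpha> z = - (of_real ((A z)\<^sup>2 * scal_coeff \<alpha> (x z)) * z $ \<alpha>)"
proof -
  let ?V = "\<lambda>\<alpha>. - (of_real ((A z)\<^sup>2 * scal_coeff \<alpha> (x z)) * z $ \<alpha>)"
  have A: "A z > 0" using gap_pos[OF assms] .
  have F: "F (x z) > 0" using F_pos[OF assms] .
  define M where "M = P (x z) * (F (x z) - A z) - T (x z) * F1 (x z) * x z"
  have "(\<Sum>\<alpha>\<in>UNIV - {i0}. ?V \<alpha> * of_real (gap_grad \<alpha> (x z)) * cnj (z $ \<alpha>))
      = (\<Sum>\<alpha>\<in>UNIV - {i0}. of_real ((A z)\<^sup>2 * P (x z)) * (z $ \<alpha> * cnj (z $ \<alpha>)))"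
    by (rule sum.cong) auto
  also have "\<dots> = of_real ((A z)\<^sup>2 * P (x z)) * of_real (F (x z) - A z)"
    unfolding sum_distrib_left[symmetric] sum_cmod_sq ..
  finally have "(\<Sum>\<alpha>\<in>UNIV. ?V \<alpha> * of_real (gap_grad \<alpha> (x z)) * cnj (z $ \<alpha>))
     = - (of_real ((A z)\<^sup>2 * T (x z) * F1 (x z)) * (z $ i0 * cnj (z $ i0)))
       + of_real ((A z)\<^sup>2 * P (x z)) * of_real (F (x z) - A z)"
    unfolding sum_split_i0 by (simp add: mult_ac)
  also have "\<dots> = of_real ((A z)\<^sup>2 * M)"
    unfolding complex_norm_square[symmetric] M_def of_real_mult[symmetric] of_real_add[symmetric] of_real_minus[symmetric]
    by (simp add: algebra_simps)
  finally have sm: "(\<Sum>\<alpha>\<in>UNIV. ?V \<alpha> * of_real (gap_grad \<alpha> (x z)) * cnj (z $ \<alpha>)) = of_real ((A z)\<^sup>2 * M)" .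
  have M: "M = - Q (x z) * F (x z) - P (x z) * A z"
    using P_eq[OF assms] by (simp add: M_def algebra_simps)
  have key: "M * gap_grad \<gamma> (x z) + scal_coeff \<gamma> (x z) * A z * gap_hess \<gamma> (x z) = - (gap_grad \<gamma> (x z) * (F (x z) * Q (x z))
     + (if \<gamma> = i0 then A z * (F1 (x z) * Q (x z) + F (x z) * Q1 (x z)) else 0))" for \<gamma>
  proof (cases "\<gamma> = i0")
    case True
    have "F (x z) * (T (x z) * (F1 (x z) + x z * F2 (x z)) - F1 (x z) * P (x z))
       = F (x z) * (- (F1 (x z) * Q (x z) + F (x z) * Q1 (x z)))"
      using P_eq[OF assms] T_eq[OF assms] unfolding det_num_def by algebra
    then have "T (x z) * (F1 (x z) + x z * F2 (x z)) - F1 (x z) * P (x z)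
       = - (F1 (x z) * Q (x z) + F (x z) * Q1 (x z))"
      using F by simp
    then show ?thesis
      unfolding M True gap_grad_simps gap_hess_simps scal_coeff_simps if_True simp_thms by algebra
  next
    case False
    then show ?thesis unfolding M by (simp add: algebra_simps)
  qed
  have "(\<Sum>\<alpha>\<in>UNIV. ?V \<alpha> * g z $ \<alpha> $ \<gamma>) = d_zbar \<gamma> (scal g) z" for \<gamma>
  proof -
    have "(\<Sum>\<alpha>\<in>UNIV. ?V \<alpha> * g z $ \<alpha> $ \<gamma>) = of_real (M * gap_grad \<gamma> (x z) + scal_coeff \<gamma> (x z) * A z * gap_hess \<gamma> (x z)) * z $ \<gamma>"
      unfolding sum_mult_hartogs_metric[OF assms] sm using A by (simp add: field_simps power2_eq_square)
    then show ?thesis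
      unfolding key d_zbar_scal[OF assms] by (simp only: of_real_minus mult_minus_left)
  qed
  from sum_matrix_inv_eq[OF matrix_inv_hartogs_metric(1)[OF assms det_num_pos[OF assms]] this]
  show ?thesis by (simp add: scal_field_def)
qed

text \<open>
  In a fibre direction the radial coefficients are constant, so only the factor \<open>A\<^sup>2\<close> is
  differentiated, with \<open>\<partial>A / \<partial>zbar\<^sub>\<gamma> = - z\<^sub>\<gamma>\<close>.
\<close>
lemma d_zbar_scal_field:
  assumes "z \<in> S" "\<gamma> \<noteq> i0"
  shows "d_zbar \<gamma> (scal_field g \<alpha>) z = of_real (2 * A z * scal_coeff \<alpha> (x z)) * z $ \<gamma> * z $ \<alpha>"
proof -
  define W' where "W' = (if \<alpha> = i0 then T1 (x z) else P1 (x z))"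
  have DW: "(scal_coeff \<alpha> has_real_derivative W') (at (x z))"
  proof -
    have "scal_coeff \<alpha> = (if \<alpha> = i0 then T else P)"
      by (auto simp: scal_coeff_def fun_eq_iff)
    then show ?thesis using DT[OF assms(1)] DP[OF assms(1)] by (simp add: W'_def)
  qed
  have "((\<lambda>t. t\<^sup>2) has_real_derivative 2 * A z) (at (A z))"
    by (auto intro!: derivative_eq_intros)
  note C = has_wirtinger_cmult[OF has_wirtinger_mult[OF has_wirtinger_mult[OF
          has_wirtinger_gap_compose[OF assms(1) this] has_wirtinger_radial[OF DW]] has_wirtinger_nth[of \<alpha>]], of "- 1"]
  show ?thesis
    by (rule trans[OF has_wirtinger_imp_d_z(2)[OF has_wirtinger_transform_open[OF C open_S assms(1)]]])
      (use assms(2) in \<open>simp_all add: scal_field_hartogs_metric mult_ac\<close>)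
qed

text \<open>
  This is where a fibre of positive dimension is essential: the dependence of the
  gradient field on the fibre through \<open>A\<^sup>2\<close> is never holomorphic, so both coefficients \<open>T\<close> and
  \<open>P\<close> must vanish, and then so does \<open>Q\<close>.
\<close>
lemma extremal_imp_Q_zero:
  assumes "\<And>\<alpha> \<gamma>. d_zbar \<gamma> (scal_field g \<alpha>) z = 0"
    and "z \<in> S" "z $ i0 \<noteq> 0" "j \<noteq> i0" "z $ j \<noteq> 0"
  shows "Q (x z) = 0"
proof -
  have "of_real (2 * A z * scal_coeff \<alpha> (x z)) * z $ j * z $ \<alpha> = 0" for \<alpha>
    using assms(1)[of j \<alpha>] d_zbar_scal_field[OF assms(2,4)] by simp
  then have "scal_coeff \<alpha> (x z) = 0" if "z $ \<alpha> \<noteq> 0" for \<alpha>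
    using that gap_pos[OF assms(2)] assms(5) by (auto simp: mult_eq_0_iff)
  from this[of i0] this[of j] have "T (x z) = 0" "P (x z) = 0"
    using assms(3-5) by simp_all
  with P_eq[OF assms(2)] F_pos[OF assms(2)] show ?thesis by simp
qed

end

section \<open>The radial differential equation\<close>

text \<open>
  The curvature quantities are rational expressions in \<open>t\<close> and the derivatives of \<open>F\<close>, of
  order up to five, and have to be differentiated once more. Closing the derivatives \<open>D k\<close>
  under the arithmetic operations gives an algebra of functions stable under differentiation,
  so that none of these higher derivatives is ever written out.
\<close>
inductive smooth_expr :: "real set \<Rightarrow> (nat \<Rightarrow> real \<Rightarrow> real) \<Rightarrow> (real \<Rightarrow> real) \<Rightarrow> bool"
  for I D where
  base: "smooth_expr I D (D k)"
| ident: "smooth_expr I D (\<lambda>t. t)"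
| const: "smooth_expr I D (\<lambda>t. c)"
| add: "smooth_expr I D p \<Longrightarrow> smooth_expr I D q \<Longrightarrow> smooth_expr I D (\<lambda>t. p t + q t)"
| mult: "smooth_expr I D p \<Longrightarrow> smooth_expr I D q \<Longrightarrow> smooth_expr I D (\<lambda>t. p t * q t)"
| inv: "smooth_expr I D p \<Longrightarrow> (\<And>t. t \<in> I \<Longrightarrow> p t \<noteq> 0) \<Longrightarrow> smooth_expr I D (\<lambda>t. inverse (p t))"

lemma smooth_expr_deriv:
  assumes D: "\<And>k t. t \<in> I \<Longrightarrow> (D k has_real_derivative D (Suc k) t) (at t)"
    and "smooth_expr I D p"
  shows "\<exists>p'. smooth_expr I D p' \<and> (\<forall>t\<in>I. (p has_real_derivative p' t) (at t))"
  using assms(2)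
proof induction
  case (base k)
  show ?case using D smooth_expr.base by blast
next
  case ident
  show ?case by (intro exI[of _ "\<lambda>_. 1"]) (auto intro: smooth_expr.const)
next
  case (const c)
  show ?case by (intro exI[of _ "\<lambda>_. 0"]) (auto intro: smooth_expr.const)
next
  case (add p q)
  then obtain p' q' where *: "smooth_expr I D p'" "smooth_expr I D q'"
    "\<forall>t\<in>I. (p has_real_derivative p' t) (at t)" "\<forall>t\<in>I. (q has_real_derivative q' t) (at t)" by blast
  show ?case
    by (rule exI[of _ "\<lambda>t. p' t + q' t"]) (use * in \<open>auto intro: smooth_expr.add DERIV_add\<close>)
next
  case (mult p q)
  then obtain p' q' where *: "smooth_expr I D p'" "smooth_expr I D q'"
    "\<forall>t\<in>I. (p has_real_derivative p' t) (at t)" "\<forall>t\<in>I. (q has_real_derivative q' t) (at t)" by blast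
  show ?case
    by (rule exI[of _ "\<lambda>t. p' t * q t + q' t * p t"])
      (use * mult in \<open>auto intro: smooth_expr.add smooth_expr.mult DERIV_mult\<close>)
next
  case (inv p)
  then obtain p' where *: "smooth_expr I D p'" "\<forall>t\<in>I. (p has_real_derivative p' t) (at t)" by blast
  have "((\<lambda>t. inverse (p t)) has_real_derivative - 1 * (p' t * (inverse (p t) * inverse (p t)))) (at t)" if "t \<in> I" for t
    using *(2) inv.hyps(2) that by (auto intro!: derivative_eq_intros)
  moreover have "smooth_expr I D (\<lambda>t. - 1 * (p' t * (inverse (p t) * inverse (p t))))"
    using *(1) inv.hyps by (intro smooth_expr.mult smooth_expr.const smooth_expr.inv)
  ultimately show ?case by blast
qed

text \<open>
  The derivatives are taken as iterates of \<open>p \<mapsto> frechet_derivative p (at t) 1\<close> on functions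
  defined on the whole line, the form in which smoothness of \<open>p\<close> is inherited directly.
\<close>
lemma smooth_on_imp_derivatives:
  fixes F :: "real \<Rightarrow> real"
  assumes "smooth_on I F"
  obtains D where "D 0 = F" "\<And>k t. t \<in> I \<Longrightarrow> (D k has_real_derivative D (Suc k) t) (at t)"
proof -
  define d :: "(real \<Rightarrow> real) \<Rightarrow> real \<Rightarrow> real" where "d p = (\<lambda>t. frechet_derivative p (at t) 1)" for p
  have diff: "p differentiable (at t)" if "smooth_on I p" "t \<in> I" for p :: "real \<Rightarrow> real" and t
    using that unfolding smooth_on_def by (metis Ck_on.simps(2))
  have D: "(p has_real_derivative d p t) (at t)" if "smooth_on I p" "t \<in> I" for p t
  proof -
    have fd: "(p has_derivative frechet_derivative p (at t)) (at t)"
      using diff[OF that] by (simp add: frechet_derivative_works)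
    then have "linear (frechet_derivative p (at t))"
      using has_derivative_linear by blast
    then have "frechet_derivative p (at t) = (*) (d p t)"
      by (auto simp: d_def fun_eq_iff) (metis linear_scale mult.commute mult.right_neutral real_scaleR_def)
    with fd show ?thesis by (simp add: has_field_derivative_def)
  qed
  have "smooth_on I (d p)" if "smooth_on I p" for p
    using that unfolding smooth_on_def d_def by (metis Ck_on.simps(2))
  then have sm: "smooth_on I ((d ^^ k) F)" for k
    by (induction k) (use assms in auto)
  show ?thesis
    by (rule that[of "\<lambda>k. (d ^^ k) F"]) (use D[OF sm] in auto)
qed

lemma radial_interval:
  fixes x0 :: ereal
  assumes "0 < x0"
  shows "convex {t. 0 < t \<and> ereal t < x0}" "eventually (\<lambda>t. 0 < t \<and> ereal t < x0) (at_right 0)"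
proof -
  show "convex {t. 0 < t \<and> ereal t < x0}"
  proof (cases x0)
    case (real r)
    then have "{t. 0 < t \<and> ereal t < x0} = {0<..<r}" by auto
    then show ?thesis by simp
  next
    case PInf
    then have "{t. 0 < t \<and> ereal t < x0} = {0<..}" by auto
    then show ?thesis by simp
  qed (use assms in auto)
  obtain r where r: "0 < ereal r" "ereal r < x0" using ereal_dense2[OF assms] by auto
  have "eventually (\<lambda>t. 0 < t \<and> t < r) (at_right 0)"
    using r by (auto simp: eventually_at_right[OF r(1)[simplified]] intro!: exI[of _ r])
  then show "eventually (\<lambda>t. 0 < t \<and> ereal t < x0) (at_right 0)"
    by (rule eventually_mono) (use r in \<open>auto intro: order.strict_trans[of _ "ereal r"]\<close>)
qed

text \<open>
  The equation \<open>(t L')' = 0\<close> for \<open>L = ln b\<close> gives \<open>b = const * t\<^sup>c\<close>, and the positive limit of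
  \<open>b\<close> at \<open>0\<close> forces \<open>c = 0\<close>. So \<open>b = a\<close> is constant, which for \<open>y = t F' / F\<close> reads
  \<open>y' = - a / F\<^sup>2\<close>. Then \<open>y\<^sup>2 - y - a t / F\<^sup>2\<close> is a first integral; it vanishes because it does so
  in the limit \<open>t \<rightarrow> 0\<close>, and substituting back into \<open>b = a\<close> leaves \<open>F'' = 0\<close>. The solutions
  with other values of the first integral are not affine and are excluded only by
  the behaviour at \<open>0\<close>.
\<close>
lemma hartogs_function_affine:
  fixes x0 :: ereal and F F1 F2 L1 L2 b :: "real \<Rightarrow> real"
  assumes I_def: "I = {t. 0 < t \<and> ereal t < x0}" and x0: "0 < x0"
    and DF: "\<And>t. t \<in> I \<Longrightarrow> (F has_real_derivative F1 t) (at t)"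
    and DF1: "\<And>t. t \<in> I \<Longrightarrow> (F1 has_real_derivative F2 t) (at t)"
    and F_pos: "\<And>t. t \<in> I \<Longrightarrow> 0 < F t"
    and b_eq: "\<And>t. t \<in> I \<Longrightarrow> b t = t * (F1 t)\<^sup>2 - F t * (F1 t + t * F2 t)"
    and b_pos: "\<And>t. t \<in> I \<Longrightarrow> 0 < b t"
    and DL: "\<And>t. t \<in> I \<Longrightarrow> ((\<lambda>t. ln (b t)) has_real_derivative L1 t) (at t)"
    and DL1: "\<And>t. t \<in> I \<Longrightarrow> (L1 has_real_derivative L2 t) (at t)"
    and L: "\<And>t. t \<in> I \<Longrightarrow> L1 t + t * L2 t = 0"
    and limF: "(F \<longlongrightarrow> F0) (at_right 0)" "0 < F0"
    and limb: "(b \<longlongrightarrow> b0) (at_right 0)" "0 < b0"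
    and limF1: "((\<lambda>t. t * F1 t) \<longlongrightarrow> 0) (at_right 0)"
  obtains m where "0 < m" "\<And>t. t \<in> I \<Longrightarrow> F t = F0 - m * t"
proof -
  have conv: "convex I" and ev: "eventually (\<lambda>t. t \<in> I) (at_right 0)"
    using radial_interval[OF x0] by (simp_all add: I_def)
  have nz: "t > 0" if "t \<in> I" for t using that by (simp add: I_def)
  have const: "\<exists>c. \<forall>t\<in>I. p t = c" if "\<And>t. t \<in> I \<Longrightarrow> (p has_real_derivative 0) (at t)" for p :: "real \<Rightarrow> real"
    using has_field_derivative_zero_constant[OF conv, of p] has_field_derivative_at_within[OF that] by blast
  have limit: "c = l" if "\<forall>t\<in>I. p t = c" "(p \<longlongrightarrow> l) (at_right 0)" for p :: "real \<Rightarrow> real" and c l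
  proof -
    have "eventually (\<lambda>t. p t = c) (at_right 0)"
      using ev by (rule eventually_mono) (use that(1) in blast)
    then have "((\<lambda>_. c) \<longlongrightarrow> l) (at_right (0::real))"
      using that(2) by (simp add: tendsto_cong)
    then show ?thesis by (simp add: tendsto_const_iff)
  qed
  have "((\<lambda>t. t * L1 t) has_real_derivative 0) (at t)" if "t \<in> I" for t
    by (rule DERIV_cong[OF DERIV_mult[OF DERIV_ident DL1[OF that]]]) (use L[OF that] in \<open>simp add: mult.commute\<close>)
  from const[OF this] obtain c where c: "\<And>t. t \<in> I \<Longrightarrow> t * L1 t = c" by auto
  have "((\<lambda>t. ln (b t) - c * ln t) has_real_derivative 0) (at t)" if "t \<in> I" for t
    by (rule DERIV_cong[OF DERIV_diff[OF DL[OF that] DERIV_cmult[OF DERIV_ln_divide[OF nz[OF that]]]]])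
      (use nz[OF that] c[OF that] in \<open>simp add: field_simps\<close>)
  from const[OF this] obtain d where d: "\<And>t. t \<in> I \<Longrightarrow> ln (b t) - c * ln t = d" by auto
  \<comment> \<open>Otherwise \<open>ln t = (ln b - d) / c\<close> would stay bounded as \<open>t \<rightarrow> 0\<close>.\<close>
  have "c = 0"
  proof (rule ccontr)
    assume "c \<noteq> 0"
    have "((\<lambda>t. (ln (b t) - d) / c) \<longlongrightarrow> (ln b0 - d) / c) (at_right 0)"
      using limb \<open>c \<noteq> 0\<close> by (intro tendsto_intros) auto
    moreover have "eventually (\<lambda>t. (ln (b t) - d) / c = ln t) (at_right 0)"
      using ev by (rule eventually_mono) (use d \<open>c \<noteq> 0\<close> in \<open>force simp: field_simps\<close>)
    ultimately have "(ln \<longlongrightarrow> (ln b0 - d) / c) (at_right 0)"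
      by (simp add: tendsto_cong)
    moreover have "filterlim ln at_infinity (at_right (0::real))"
      using ln_at_0 at_bot_le_at_infinity filterlim_mono by blast
    ultimately show False
      using not_tendsto_and_filterlim_at_infinity[of "at_right (0::real)"] by simp
  qed
  define a where "a = exp d"
  have ba: "b t = a" if "t \<in> I" for t
    using d[OF that] b_pos[OF that] \<open>c = 0\<close> by (auto simp: a_def)
  define E where "E t = (t * F1 t / F t)\<^sup>2 - t * F1 t / F t - a * t / (F t)\<^sup>2" for t
  have "(E has_real_derivative 0) (at t)" if "t \<in> I" for t
  proof -
    have ode: "a = t * (F1 t)\<^sup>2 - F t * (F1 t + t * F2 t)"
      using ba[OF that] b_eq[OF that] by simp
    have "((\<lambda>t. t * F1 t / F t) has_real_derivative - a / (F t)\<^sup>2) (at t)"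
      using F_pos[OF that] unfolding ode
      by (auto intro!: derivative_eq_intros DF[OF that] DF1[OF that] simp: field_simps power2_eq_square)
    note Dy = this
    have Dx: "((\<lambda>t. a * t / (F t)\<^sup>2) has_real_derivative a * (F t - 2 * t * F1 t) / F t ^ 3) (at t)"
      using F_pos[OF that]
      by (auto intro!: derivative_eq_intros DF[OF that] simp: field_simps power2_eq_square eval_nat_numeral)
    show ?thesis
      unfolding E_def[abs_def]
      by (rule DERIV_cong[OF DERIV_diff[OF DERIV_diff[OF DERIV_power[OF Dy, of 2] Dy] Dx]])
        (use F_pos[OF that] in \<open>simp add: field_simps eval_nat_numeral\<close>)
  qed
  from const[OF this] obtain k where k: "\<forall>t\<in>I. E t = k" by auto
  have "(E \<longlongrightarrow> (0 / F0)\<^sup>2 - 0 / F0 - a * 0 / F0\<^sup>2) (at_right 0)"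
    unfolding E_def[abs_def] using limF by (intro tendsto_intros limF1) auto
  with limit[OF k] have "k = 0" by simp
  have F2: "F2 t = 0" if "t \<in> I" for t
  proof -
    have "E t = 0" using k that \<open>k = 0\<close> by simp
    moreover have "(t * F1 t)\<^sup>2 - t * F1 t * F t - a * t = (F t)\<^sup>2 * E t"
      using F_pos[OF that] by (simp add: E_def field_simps power2_eq_square)
    ultimately have "(t * F1 t)\<^sup>2 - t * F1 t * F t - a * t = 0"
      by simp
    then have "t * (t * (F1 t)\<^sup>2 - F1 t * F t - a) = 0"
      by (simp add: algebra_simps power2_eq_square)
    then have "t * (F1 t)\<^sup>2 - F1 t * F t = a"
      using nz[OF that] by simp
    with ba[OF that] b_eq[OF that] have "F t * (t * F2 t) = 0"
      by (simp add: algebra_simps)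
    then show ?thesis using F_pos[OF that] nz[OF that] by simp
  qed
  have "(F1 has_real_derivative 0) (at t)" if "t \<in> I" for t
    using DF1[OF that] F2[OF that] by simp
  from const[OF this] obtain k1 where k1: "\<And>t. t \<in> I \<Longrightarrow> F1 t = k1" by auto
  have "((\<lambda>t. F t - k1 * t) has_real_derivative 0) (at t)" if "t \<in> I" for t
    using k1[OF that] by (auto intro!: derivative_eq_intros DF[OF that])
  from const[OF this] obtain k2 where k2: "\<forall>t\<in>I. F t - k1 * t = k2" by auto
  have "((\<lambda>t. F t - k1 * t) \<longlongrightarrow> F0 - k1 * 0) (at_right 0)"
    by (intro tendsto_intros limF)
  from limit[OF k2 this] have k20: "k2 = F0" by simp
  obtain t where t: "t \<in> I"
    using eventually_happens'[OF _ ev] by auto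
  have "F t = F0 + k1 * t" using k2 t k20 by auto
  then have "b t = - k1 * F0"
    using b_eq[OF t] k1[OF t] F2[OF t] by (simp add: algebra_simps power2_eq_square)
  then have "- k1 > 0"
    using b_pos[OF t] limF(2) by (simp add: mult_less_0_iff)
  then show ?thesis
    using k2 k20 by (intro that[of "- k1"]) auto
qed

section \<open>Affine Hartogs functions\<close>

text \<open>
  The Hessian is local even at points where nothing is differentiable, because
  \<open>frechet_derivative\<close> is chosen by a predicate that depends only on the germ of the function.
\<close>
lemma complex_hessian_cong_open:
  fixes p q :: "complex ^ 'n::finite \<Rightarrow> complex"
  assumes "open U" "z \<in> U" "\<And>w. w \<in> U \<Longrightarrow> p w = q w"
  shows "complex_hessian p z = complex_hessian q z"
proof -
  have fd: "frechet_derivative r (at w) = frechet_derivative s (at w)"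
    if "w \<in> U" "\<And>w. w \<in> U \<Longrightarrow> r w = s w" for r s :: "complex ^ 'n \<Rightarrow> complex" and w
  proof -
    have "(r has_derivative D) (at w) \<longleftrightarrow> (s has_derivative D) (at w)" for D
      using has_derivative_transform_within_open[OF _ assms(1) that(1), of r D UNIV s]
        has_derivative_transform_within_open[OF _ assms(1) that(1), of s D UNIV r] that(2) by auto
    then show ?thesis by (simp add: frechet_derivative_def)
  qed
  have "d_zbar \<beta> p w = d_zbar \<beta> q w" if "w \<in> U" for \<beta> w
    unfolding d_zbar_def using fd[OF that assms(3)] by simp
  then have "d_z \<alpha> (d_zbar \<beta> p) z = d_z \<alpha> (d_zbar \<beta> q) z" for \<alpha> \<beta>
    unfolding d_z_def using fd[OF assms(2), of "d_zbar \<beta> p" "d_zbar \<beta> q"] by simp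
  then show ?thesis by (simp add: complex_hessian_def)
qed

definition diag_map :: "('n \<Rightarrow> complex) \<Rightarrow> complex ^ 'n::finite \<Rightarrow> complex ^ 'n" where
  "diag_map c v = (\<chi> \<alpha>. c \<alpha> * v $ \<alpha>)"

lemma diag_map_has_derivative:
  "(diag_map c has_derivative diag_map c) (at z)" "diag_map c = (*v) (\<chi> \<alpha> \<beta>. if \<beta> = \<alpha> then c \<alpha> else 0)"
proof -
  show eq: "diag_map c = (*v) (\<chi> \<alpha> \<beta>. if \<beta> = \<alpha> then c \<alpha> else 0)"
    by (auto simp: fun_eq_iff diag_map_def vec_eq_iff matrix_vector_mult_def if_distrib[of "\<lambda>t. t * _"] cong: if_cong)
  show "(diag_map c has_derivative diag_map c) (at z)"
    unfolding eq by (rule bounded_linear_imp_has_derivative) (rule matrix_vector_mul_bounded_linear)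
qed

lemma biholomorphism_diag_map:
  assumes "open U" "\<And>\<alpha>. c \<alpha> \<noteq> 0"
  shows "open (diag_map c ` U)" and "biholomorphism U (diag_map c ` U) (diag_map c)"
proof -
  let ?c' = "\<lambda>\<alpha>. inverse (c \<alpha>)"
  have inv: "diag_map ?c' (diag_map c z) = z" "diag_map c (diag_map ?c' z) = z" for z
    using assms(2) by (simp_all add: diag_map_def vec_eq_iff)
  have "diag_map c ` U = diag_map ?c' -` U"
    using inv by (auto simp: image_iff) metis
  moreover have "continuous_on UNIV (diag_map ?c')"
    by (intro continuous_at_imp_continuous_on ballI has_derivative_continuous[OF diag_map_has_derivative(1)])
  ultimately show op: "open (diag_map c ` U)"
    using assms(1) by (simp add: open_vimage)
  have inj: "inj_on (diag_map c) U"
    using inv(1) by (metis inj_onI)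
  have "\<exists>M :: complex ^ 'a ^ 'a. (diag_map c has_derivative (*v) M) (at z)" for c :: "'a \<Rightarrow> complex" and z
    using diag_map_has_derivative(1)[of c z] by (subst (asm) (2) diag_map_has_derivative(2)) blast
  moreover have "(inv_into U (diag_map c) has_derivative D) (at z)"
    if "z \<in> diag_map c ` U" "(diag_map ?c' has_derivative D) (at z)" for z D
    by (rule has_derivative_transform_within_open[OF that(2) op that(1)]) (use inv(1) inj in auto)
  ultimately show "biholomorphism U (diag_map c ` U) (diag_map c)"
    unfolding biholomorphism_def holomorphic_map_on_def
    using inj by (blast intro: inj_on_imp_bij_betw)
qed

text \<open>
  For \<open>F t = F0 - m t\<close> the substitution \<open>w\<^sub>0 = sqrt (m / F0) z\<^sub>0\<close>, \<open>w\<^sub>j = z\<^sub>j / sqrt F0\<close> turns the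
  fibre gap of \<open>F\<close> into \<open>F0\<close> times the one of \<open>1 - t\<close>: the potentials differ by a constant and
  the metrics correspond. If \<open>x0 < F0 / m\<close>, the image is a proper part of the ball.
\<close>
lemma hartogs_affine_isometric_to_hyperbolic:
  fixes i0 :: "'n::finite"
  assumes op: "open (hartogs_domain i0 x0 F)" (is "open ?D")
    and pos: "0 < F0" "0 < m"
    and F: "\<And>t. 0 \<le> t \<Longrightarrow> ereal t < x0 \<Longrightarrow> F t = F0 - m * t"
  shows "\<exists>V. open V \<and> V \<subseteq> hyperbolic_space i0 \<and>
    holomorphically_isometric ?D (hartogs_metric i0 F) V (hyperbolic_metric i0)"
proof -
  define k where "k \<alpha> = (if \<alpha> = i0 then m else 1)" for \<alpha>
  define c where "c \<alpha> = sqrt (k \<alpha> / F0)" for \<alpha>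
  define \<phi> where "\<phi> = diag_map (\<lambda>\<alpha>. complex_of_real (c \<alpha>))"
  have k: "k \<alpha> > 0" for \<alpha> using pos by (simp add: k_def)
  have c: "c \<alpha> > 0" "(c \<alpha>)\<^sup>2 = k \<alpha> / F0" for \<alpha>
    using pos k[of \<alpha>] by (simp_all add: c_def)
  have bi: "open (\<phi> ` ?D)" "biholomorphism ?D (\<phi> ` ?D) \<phi>"
    unfolding \<phi>_def using biholomorphism_diag_map[OF op, of "\<lambda>\<alpha>. of_real (c \<alpha>)"] c(1)
    by (simp_all add: less_imp_neq[symmetric])
  have gapF: "fibre_gap i0 F z = fibre_gap i0 (\<lambda>t. F0 - m * t) z" "0 < fibre_gap i0 (\<lambda>t. F0 - m * t) z" if "z \<in> ?D" for z
    using that F[of "(cmod (z $ i0))\<^sup>2"] by (auto simp: hartogs_domain_def fibre_gap_def)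
  have \<phi>_nth: "\<phi> z $ \<alpha> = of_real (c \<alpha>) * z $ \<alpha>" for z \<alpha>
    by (simp add: \<phi>_def diag_map_def)
  have sq: "(cmod (\<phi> z $ \<alpha>))\<^sup>2 = k \<alpha> / F0 * (cmod (z $ \<alpha>))\<^sup>2" for z \<alpha>
    by (simp add: \<phi>_nth norm_mult power_mult_distrib c)
  have gap: "fibre_gap i0 (\<lambda>t. 1 - t) (\<phi> z) = fibre_gap i0 (\<lambda>t. F0 - m * t) z / F0" for z
  proof -
    have "(\<Sum>j\<in>UNIV - {i0}. (cmod (\<phi> z $ j))\<^sup>2) = (\<Sum>j\<in>UNIV - {i0}. (cmod (z $ j))\<^sup>2 / F0)"
      by (rule sum.cong) (auto simp: sq k_def)
    also have "\<dots> = (\<Sum>j\<in>UNIV - {i0}. (cmod (z $ j))\<^sup>2) / F0"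
      by (simp add: sum_divide_distrib)
    finally show ?thesis
      using pos by (simp add: fibre_gap_def sq k_def field_simps)
  qed
  interpret R: hartogs_region i0 "\<lambda>t. F0 - m * t" "\<lambda>_. - m" "\<lambda>_. 0" ?D
    by unfold_locales (use op gapF in \<open>auto intro!: derivative_eq_intros\<close>)
  interpret H: hartogs_region i0 "\<lambda>t. 1 - t" "\<lambda>_. - 1" "\<lambda>_. 0" "\<phi> ` ?D"
    by unfold_locales (use bi(1) gapF gap pos in \<open>auto intro!: derivative_eq_intros\<close>)
  have sub: "\<phi> ` ?D \<subseteq> hyperbolic_space i0"
  proof (rule image_subsetI)
    fix z assume "z \<in> ?D"
    then have g: "0 < fibre_gap i0 (\<lambda>t. 1 - t) (\<phi> z)"
      using gap gapF pos by simp
    moreover have "0 \<le> (\<Sum>j\<in>UNIV - {i0}. (cmod (\<phi> z $ j))\<^sup>2)"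
      by (simp add: sum_nonneg)
    ultimately have "(cmod (\<phi> z $ i0))\<^sup>2 < 1"
      unfolding fibre_gap_def by linarith
    with g show "\<phi> z \<in> hyperbolic_space i0"
      by (simp add: hyperbolic_space_def hartogs_domain_def fibre_gap_def del: power2_less_1_iff)
  qed
  have metric: "hyperbolic_metric i0 (\<phi> z) $ \<alpha> $ \<beta> * of_real (c \<alpha> * c \<beta>) = hartogs_metric i0 F z $ \<alpha> $ \<beta>"
    if z: "z \<in> ?D" for z \<alpha> \<beta>
  proof -
    let ?a = "fibre_gap i0 (\<lambda>t. F0 - m * t) z"
    have "hartogs_metric i0 F z = hartogs_metric i0 (\<lambda>t. F0 - m * t) z"
      unfolding hartogs_metric_def
      by (rule complex_hessian_cong_open[OF op z])
        (use gapF in \<open>auto simp: hartogs_potential_def fibre_gap_def\<close>)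
    moreover have "hartogs_metric i0 (\<lambda>t. F0 - m * t) z $ \<alpha> $ \<beta>
      = of_real (k \<alpha> * k \<beta> / ?a\<^sup>2) * cnj (z $ \<alpha>) * z $ \<beta> + (if \<alpha> = \<beta> then of_real (k \<beta> / ?a) else 0)"
      by (auto simp: R.hartogs_metric_nth[OF z] R.gap_grad_def R.gap_hess_def k_def)
    moreover have "hyperbolic_metric i0 (\<phi> z) $ \<alpha> $ \<beta>
      = of_real (F0\<^sup>2 / ?a\<^sup>2) * cnj (\<phi> z $ \<alpha>) * \<phi> z $ \<beta> + (if \<alpha> = \<beta> then of_real (F0 / ?a) else 0)"
      unfolding hyperbolic_metric_def
      using H.hartogs_metric_nth[of "\<phi> z" \<alpha> \<beta>] z by (auto simp: H.gap_grad_def H.gap_hess_def gap power_divide)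
    moreover have "of_real (F0\<^sup>2 / ?a\<^sup>2) * cnj (\<phi> z $ \<alpha>) * \<phi> z $ \<beta> * of_real (c \<alpha> * c \<beta>)
      = of_real (F0\<^sup>2 / ?a\<^sup>2 * (c \<alpha>)\<^sup>2 * (c \<beta>)\<^sup>2) * cnj (z $ \<alpha>) * z $ \<beta>"
      by (simp add: \<phi>_nth power2_eq_square)
    moreover have "F0\<^sup>2 / ?a\<^sup>2 * (c \<alpha>)\<^sup>2 * (c \<beta>)\<^sup>2 = k \<alpha> * k \<beta> / ?a\<^sup>2"
      unfolding c(2) using pos by (simp add: power2_eq_square)
    moreover have "(if \<alpha> = \<beta> then of_real (F0 / ?a) else 0) * of_real (c \<alpha> * c \<beta>)
      = (if \<alpha> = \<beta> then complex_of_real (F0 / ?a * (c \<beta>)\<^sup>2) else 0)"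
      by (simp add: power2_eq_square)
    moreover have "F0 / ?a * (c \<beta>)\<^sup>2 = k \<beta> / ?a"
      unfolding c(2) using pos by simp
    ultimately show ?thesis by (simp only: distrib_right)
  qed
  have "riem (hyperbolic_metric i0) (\<phi> z) (frechet_derivative \<phi> (at z) u) (frechet_derivative \<phi> (at z) v)
      = riem (hartogs_metric i0 F) z u v" if z: "z \<in> ?D" for z u v
  proof -
    have fd: "frechet_derivative \<phi> (at z) = \<phi>"
      unfolding \<phi>_def by (rule frechet_derivative_at[symmetric]) (rule diag_map_has_derivative)
    have "hermitian_form (hyperbolic_metric i0 (\<phi> z)) (\<phi> u) (\<phi> v) = hermitian_form (hartogs_metric i0 F z) u v"
      unfolding hermitian_form_def metric[OF z, symmetric] by (simp add: \<phi>_nth mult_ac)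
    then show ?thesis by (simp add: riem_def fd)
  qed
  with bi sub show ?thesis
    unfolding holomorphically_isometric_def by blast
qed

section \<open>Extremal Hartogs metrics\<close>

lemma hermitian_posdef_diag:
  assumes "hermitian_posdef A"
  shows "0 < Re (A $ i $ i)"
proof -
  have "hermitian_form A (axis i 1) (axis i 1) = (\<Sum>\<alpha>\<in>UNIV. \<Sum>\<beta>\<in>UNIV. if \<beta> = i then (if \<alpha> = i then A $ \<alpha> $ \<beta> else 0) else 0)"
    unfolding hermitian_form_def by (intro sum.cong) (auto simp: axis_def)
  then have "hermitian_form A (axis i 1) (axis i 1) = A $ i $ i" by simp
  moreover have "axis i 1 \<noteq> (0 :: complex ^ 'a)" by (simp add: axis_eq_0_iff)
  ultimately show ?thesis using assms unfolding hermitian_posdef_def by metis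
qed

text \<open>
  On the positive real axis the derivative of \<open>F (|w|\<^sup>2)\<close> is \<open>2 sqrt t F' t\<close> with
  \<open>t = |w|\<^sup>2\<close>. By smoothness at \<open>w = 0\<close> it stays bounded, and another factor \<open>sqrt t\<close> makes it
  tend to \<open>0\<close>.
\<close>
lemma radial_smooth_imp_limit:
  fixes x0 :: ereal and F F1 :: "real \<Rightarrow> real"
  assumes x0: "0 < x0"
    and DF: "\<And>t. 0 < t \<Longrightarrow> ereal t < x0 \<Longrightarrow> (F has_real_derivative F1 t) (at t)"
    and sm: "smooth_on {w :: complex. ereal ((cmod w)\<^sup>2) < x0} (\<lambda>w. F ((cmod w)\<^sup>2))"
  shows "((\<lambda>t. t * F1 t) \<longlongrightarrow> 0) (at_right 0)"
proof -
  let ?U = "{w :: complex. ereal ((cmod w)\<^sup>2) < x0}"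
  define h where "h w = frechet_derivative (\<lambda>w. F ((cmod w)\<^sup>2)) (at w) 1" for w :: complex
  have "Ck_on (Suc 0) ?U (\<lambda>w. F ((cmod w)\<^sup>2))"
    using sm unfolding smooth_on_def by blast
  then have cont: "continuous_on ?U h"
    unfolding h_def[abs_def] by simp
  have "((\<lambda>t. complex_of_real (sqrt t)) \<longlongrightarrow> of_real (sqrt 0)) (at_right 0)"
    by (intro tendsto_intros)
  moreover have "eventually (\<lambda>t. complex_of_real (sqrt t) \<in> ?U) (at_right 0)"
    using radial_interval(2)[OF x0] by (rule eventually_mono) auto
  ultimately have "((\<lambda>t. h (of_real (sqrt t))) \<longlongrightarrow> h (of_real (sqrt 0))) (at_right 0)"
    using x0 by (intro continuous_on_tendsto_compose[OF cont]) (auto simp: zero_ereal_def)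
  then have "((\<lambda>t. sqrt t * h (of_real (sqrt t)) / 2) \<longlongrightarrow> sqrt 0 * h (of_real (sqrt 0)) / 2) (at_right 0)"
    by (intro tendsto_intros) auto
  moreover have "eventually (\<lambda>t. sqrt t * h (of_real (sqrt t)) / 2 = t * F1 t) (at_right 0)"
    using radial_interval(2)[OF x0]
  proof (rule eventually_mono)
    fix t assume t: "0 < t \<and> ereal t < x0"
    let ?w = "complex_of_real (sqrt t)"
    have w: "(cmod ?w)\<^sup>2 = t" using t by simp
    have "((\<lambda>w. w \<bullet> w) has_derivative (\<lambda>v. ?w \<bullet> v + v \<bullet> ?w)) (at ?w)"
      by (auto intro!: derivative_eq_intros)
    then have "((\<lambda>w. (cmod w)\<^sup>2) has_derivative (\<lambda>v. 2 * (?w \<bullet> v))) (at ?w)"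
      by (simp add: power2_norm_eq_inner inner_commute)
    from has_derivative_compose[OF this, of F] DF[of t] t w
    have "((\<lambda>w. F ((cmod w)\<^sup>2)) has_derivative (\<lambda>v. F1 t * (2 * (?w \<bullet> v)))) (at ?w)"
      by (simp add: has_field_derivative_def)
    then have "h ?w = F1 t * (2 * sqrt t)"
      unfolding h_def by (simp add: frechet_derivative_at[symmetric] inner_complex_def)
    then show "sqrt t * h ?w / 2 = t * F1 t"
      using t by (simp add: mult_ac)
  qed
  ultimately show ?thesis
    by (simp add: tendsto_cong)
qed

theorem theorem1p1:
  fixes i0 :: "'n::finite" and x0 :: ereal and F :: "real \<Rightarrow> real"
  assumes "CARD('n) \<ge> 2"
    and "strongly_pseudoconvex_hartogs i0 x0 F"
    and "extremal_on (hartogs_domain i0 x0 F) (hartogs_metric i0 F)"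
  shows "\<exists>V. open V \<and> V \<subseteq> hyperbolic_space i0 \<and>
    holomorphically_isometric (hartogs_domain i0 x0 F) (hartogs_metric i0 F) V (hyperbolic_metric i0)"
proof -
  define I where "I = {t. 0 < t \<and> ereal t < x0}"
  let ?D = "hartogs_domain i0 x0 F" and ?g = "hartogs_metric i0 F"
  define S where "S = ?D \<inter> {z. z $ i0 \<noteq> 0}"
  have x0: "0 < x0" and F_pos: "\<And>t. 0 \<le> t \<Longrightarrow> ereal t < x0 \<Longrightarrow> 0 < F t"
    and F_cont: "continuous_on {x. 0 \<le> x \<and> ereal x < x0} F"
    and F_smooth: "smooth_on I F"
    and F_smooth0: "smooth_on {w :: complex. ereal ((cmod w)\<^sup>2) < x0} (\<lambda>w. F ((cmod w)\<^sup>2))"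
    and kahler: "kahler_metric_on ?D ?g"
    using assms(2) unfolding strongly_pseudoconvex_hartogs_def hartogs_function_def I_def by blast+
  have opD: "open ?D" and posdef: "\<And>z. z \<in> ?D \<Longrightarrow> hermitian_posdef (?g z)"
    and g_smooth: "smooth_on ?D (\<lambda>z. ?g z $ i0 $ i0)"
    using kahler unfolding kahler_metric_on_def by blast+
  have ext: "\<And>z \<alpha> \<gamma>. z \<in> ?D \<Longrightarrow> d_zbar \<gamma> (scal_field ?g \<alpha>) z = 0"
    using assms(3) unfolding extremal_on_def by blast
  have "\<exists>j. j \<noteq> i0"
  proof (rule ccontr)
    assume "\<not> (\<exists>j. j \<noteq> i0)"
    then have "(UNIV :: 'n set) = {i0}" by auto
    then have "CARD('n) = card {i0}" by (rule arg_cong)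
    with assms(1) show False by simp
  qed
  then obtain j where j: "j \<noteq> i0" by blast
  obtain D where D: "D 0 = F" "\<And>k t. t \<in> I \<Longrightarrow> (D k has_real_derivative D (Suc k) t) (at t)"
    using smooth_on_imp_derivatives[OF F_smooth] by blast
  define F1 where "F1 = D 1"
  define F2 where "F2 = D 2"
  have DF: "\<And>t. t \<in> I \<Longrightarrow> (F has_real_derivative F1 t) (at t)"
    and DF1: "\<And>t. t \<in> I \<Longrightarrow> (F1 has_real_derivative F2 t) (at t)"
    using D(2)[of _ 0] D(2)[of _ 1] by (simp_all add: D(1) F1_def F2_def numeral_2_eq_2)
  have FI: "0 < F t" if "t \<in> I" for t
    using that F_pos[of t] by (simp add: I_def)
  have SI: "(cmod (z $ i0))\<^sup>2 \<in> I" if "z \<in> S" for z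
    using that by (auto simp: S_def I_def hartogs_domain_def)
  have "open {z :: complex ^ 'n. z $ i0 \<noteq> 0}"
    by (intro open_Collect_neq continuous_intros)
  then have opS: "open S" using opD by (auto simp: S_def)
  interpret R: hartogs_region i0 F F1 F2 S
    by unfold_locales (use opS DF DF1 SI in \<open>auto simp: S_def hartogs_domain_def fibre_gap_def\<close>)
  \<comment> \<open>Along the slice with vanishing fibre coordinates the metric determines \<open>det_num\<close>, so
    positivity and continuity of the metric, also at the origin, pass to \<open>det_num\<close>.\<close>
  define p where "p t = (axis i0 (of_real (sqrt t)) :: complex ^ 'n)" for t
  have p: "p t \<in> S" "(cmod (p t $ i0))\<^sup>2 = t" "fibre_gap i0 F (p t) = F t" if "t \<in> I" for t
    using that F_pos[of t] by (auto simp: p_def S_def I_def hartogs_domain_def fibre_gap_def axis_def)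
  have g00: "?g (p t) $ i0 $ i0 = of_real (R.det_num t / (F t)\<^sup>2)" if t: "t \<in> I" for t
  proof -
    have "cnj (p t $ i0) * p t $ i0 = of_real t"
      using p(2)[OF t] complex_norm_square[of "p t $ i0"] by (simp add: mult.commute)
    moreover have "F t > 0" using F_pos t by (simp add: I_def)
    ultimately show ?thesis
      unfolding R.hartogs_metric_nth[OF p(1)[OF t]] p(2,3)[OF t]
      by (simp add: R.det_num_def mult.assoc field_simps power2_eq_square)
  qed
  have b_pos: "0 < R.det_num t" if t: "t \<in> I" for t
  proof -
    have "0 < Re (?g (p t) $ i0 $ i0)"
      by (rule hermitian_posdef_diag[OF posdef]) (use p(1)[OF t] in \<open>simp add: S_def\<close>)
    then show ?thesis
      unfolding g00[OF t] using F_pos[of t] t by (simp add: I_def zero_less_divide_iff)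
  qed
  note expr = smooth_expr.intros[of I D]
  have F_expr: "smooth_expr I D F" "smooth_expr I D F1" "smooth_expr I D F2"
    using smooth_expr.base[of I D] by (simp_all add: F1_def F2_def D(1)[symmetric])
  have b_expr: "smooth_expr I D R.det_num"
  proof -
    have "smooth_expr I D (\<lambda>t. t * (F1 t * F1 t) + - 1 * (F t * (F1 t + t * F2 t)))"
      by (intro expr(2-5) F_expr)
    moreover have "(\<lambda>t. t * (F1 t * F1 t) + - 1 * (F t * (F1 t + t * F2 t))) = R.det_num"
      by (auto simp: R.det_num_def fun_eq_iff power2_eq_square)
    ultimately show ?thesis by simp
  qed
  have ib_expr: "smooth_expr I D (\<lambda>t. inverse (R.det_num t))"
    by (rule expr(6)[OF b_expr]) (use b_pos in force)
  have iF_expr: "smooth_expr I D (\<lambda>t. inverse (F t))"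
    by (rule expr(6)[OF F_expr(1)]) (use FI in force)
  have deriv: "\<exists>q'. smooth_expr I D q' \<and> (\<forall>t\<in>I. (q has_real_derivative q' t) (at t))"
    if "smooth_expr I D q" for q
    using smooth_expr_deriv[OF D(2) that] .
  obtain b1 where b1: "smooth_expr I D b1" "\<forall>t\<in>I. (R.det_num has_real_derivative b1 t) (at t)"
    using deriv[OF b_expr] by blast
  define L1 where "L1 t = b1 t * inverse (R.det_num t)" for t
  have L1_expr: "smooth_expr I D L1"
    unfolding L1_def[abs_def] by (intro expr(5) b1(1) ib_expr)
  have DL: "((\<lambda>t. ln (R.det_num t)) has_real_derivative L1 t) (at t)" if "t \<in> I" for t
    using DERIV_chain2[where f = ln and g = R.det_num, OF DERIV_ln_divide[OF b_pos[OF that]] bspec[OF b1(2) that]]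
    by (simp add: L1_def field_simps)
  obtain L2 where L2: "smooth_expr I D L2" "\<forall>t\<in>I. (L1 has_real_derivative L2 t) (at t)"
    using deriv[OF L1_expr] by blast
  define Q where "Q t = (L1 t + t * L2 t) * inverse (R.det_num t)" for t
  have Q_expr: "smooth_expr I D Q"
    unfolding Q_def[abs_def] by (intro expr(2,4,5) L1_expr L2(1) ib_expr)
  obtain Q1 where Q1: "smooth_expr I D Q1" "\<forall>t\<in>I. (Q has_real_derivative Q1 t) (at t)"
    using deriv[OF Q_expr] by blast
  define T where "T t = (2 * (F t * F1 t * Q t) + F t * F t * Q1 t) * inverse (R.det_num t)" for t
  have T_expr: "smooth_expr I D T"
    unfolding T_def[abs_def] by (intro expr(2-5) F_expr Q_expr Q1(1) ib_expr)
  obtain T1 where T1: "\<forall>t\<in>I. (T has_real_derivative T1 t) (at t)"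
    using deriv[OF T_expr] by blast
  define P where "P t = T t * F1 t * t * inverse (F t) + - 1 * Q t" for t
  have P_expr: "smooth_expr I D P"
    unfolding P_def[abs_def] by (intro expr(2-5) F_expr Q_expr T_expr iF_expr)
  obtain P1 where P1: "\<forall>t\<in>I. (P has_real_derivative P1 t) (at t)"
    using deriv[OF P_expr] by blast
  interpret C: hartogs_curvature i0 F F1 F2 S L1 L2 Q Q1 T T1 P P1
  proof
    fix z assume z: "z \<in> S"
    note t = SI[OF z]
    have nz: "R.det_num ((cmod (z $ i0))\<^sup>2) > 0" "F ((cmod (z $ i0))\<^sup>2) > 0"
      using b_pos[OF t] R.F_pos[OF z] by auto
    show "Q (R.x z) * R.det_num (R.x z) = L1 (R.x z) + R.x z * L2 (R.x z)"
      using nz by (simp add: Q_def)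
    show "T (R.x z) * R.det_num (R.x z) = 2 * F (R.x z) * F1 (R.x z) * Q (R.x z) + (F (R.x z))\<^sup>2 * Q1 (R.x z)"
      using nz by (simp add: T_def power2_eq_square mult.assoc)
    show "P (R.x z) * F (R.x z) = T (R.x z) * F1 (R.x z) * R.x z - Q (R.x z) * F (R.x z)"
      using nz by (simp add: P_def algebra_simps)
  qed (use SI b_pos DL L2(2) Q1(2) T1 P1 in blast)+
  have L_zero: "L1 t + t * L2 t = 0" if t: "t \<in> I" for t
  proof -
    have Ft: "F t > 0" using F_pos t by (simp add: I_def)
    \<comment> \<open>A point over \<open>t\<close> with nonzero fibre coordinate; \<open>F t / 2\<close> keeps it inside the fibre.\<close>
    define z where "z = p t + axis j (of_real (sqrt (F t / 2)))"
    have zi: "z $ i0 = of_real (sqrt t)" "z $ j = of_real (sqrt (F t / 2))"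
      using j by (simp_all add: z_def p_def axis_def)
    have "(\<Sum>k\<in>UNIV - {i0}. (cmod (z $ k))\<^sup>2) = (\<Sum>k\<in>UNIV - {i0}. if k = j then F t / 2 else 0)"
      by (rule sum.cong) (use Ft in \<open>auto simp: z_def p_def axis_def\<close>)
    then have "(\<Sum>k\<in>UNIV - {i0}. (cmod (z $ k))\<^sup>2) = F t / 2"
      using j by simp
    moreover have xt: "(cmod (z $ i0))\<^sup>2 = t"
      using t by (simp add: zi I_def)
    ultimately have z: "z \<in> S"
      using t Ft zi by (auto simp: S_def hartogs_domain_def I_def)
    have "Q ((cmod (z $ i0))\<^sup>2) = 0"
      by (rule C.extremal_imp_Q_zero[OF ext z _ j]) (use z t Ft zi in \<open>auto simp: S_def I_def\<close>)
    then show ?thesis using xt b_pos[OF t] by (simp add: Q_def)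
  qed
  have ev: "eventually (\<lambda>t. t \<in> I) (at_right 0)"
    using radial_interval(2)[OF x0] by (simp add: I_def)
  have F0: "0 < F 0" using F_pos[of 0] x0 by (simp add: zero_ereal_def)
  have limF: "(F \<longlongrightarrow> F 0) (at_right 0)"
    using x0 by (intro continuous_on_tendsto_compose[OF F_cont, of "\<lambda>t. t"] tendsto_ident_at eventually_mono[OF ev])
      (auto simp: I_def zero_ereal_def)
  have zero_in: "(0 :: complex ^ 'n) \<in> ?D"
    using F0 x0 by (simp add: hartogs_domain_def zero_ereal_def)
  have limb: "(R.det_num \<longlongrightarrow> (F 0)\<^sup>2 * Re (?g 0 $ i0 $ i0)) (at_right 0)"
  proof -
    have "Ck_on 0 ?D (\<lambda>z. ?g z $ i0 $ i0)"
      using g_smooth unfolding smooth_on_def by blast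
    then have cont: "continuous_on ?D (\<lambda>z. ?g z $ i0 $ i0)" by simp
    have "((\<lambda>t. complex_of_real (sqrt t)) \<longlongrightarrow> of_real (sqrt 0)) (at_right 0)"
      by (intro tendsto_intros)
    then have "((\<lambda>t. p t $ k) \<longlongrightarrow> 0 $ k) (at_right 0)" for k
      by (cases "k = i0") (simp_all add: p_def axis_def)
    then have "(p \<longlongrightarrow> 0) (at_right 0)"
      by (rule vec_tendstoI)
    then have "((\<lambda>t. ?g (p t) $ i0 $ i0) \<longlongrightarrow> ?g 0 $ i0 $ i0) (at_right 0)"
      using p(1) zero_in
      by (intro continuous_on_tendsto_compose[OF cont] eventually_mono[OF ev]) (auto simp: S_def)
    then have "((\<lambda>t. (F t)\<^sup>2 * Re (?g (p t) $ i0 $ i0)) \<longlongrightarrow> (F 0)\<^sup>2 * Re (?g 0 $ i0 $ i0)) (at_right 0)"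
      by (intro tendsto_mult tendsto_power tendsto_Re limF)
    moreover have "eventually (\<lambda>t. (F t)\<^sup>2 * Re (?g (p t) $ i0 $ i0) = R.det_num t) (at_right 0)"
      using ev
    proof (rule eventually_mono)
      fix t assume t: "t \<in> I"
      then have "F t > 0" using F_pos by (simp add: I_def)
      then show "(F t)\<^sup>2 * Re (?g (p t) $ i0 $ i0) = R.det_num t"
        unfolding g00[OF t] by simp
    qed
    ultimately show ?thesis by (simp add: tendsto_cong)
  qed
  have "0 < (F 0)\<^sup>2 * Re (?g 0 $ i0 $ i0)"
    using F0 hermitian_posdef_diag[OF posdef[OF zero_in], of i0] by simp
  moreover have "((\<lambda>t. t * F1 t) \<longlongrightarrow> 0) (at_right 0)"
    using radial_smooth_imp_limit[OF x0 _ F_smooth0] DF by (simp add: I_def)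
  ultimately obtain m where m: "0 < m" "\<And>t. t \<in> I \<Longrightarrow> F t = F 0 - m * t"
    using hartogs_function_affine[OF I_def x0 DF DF1 FI R.det_num_def b_pos DL _ L_zero limF F0 limb] L2(2) by blast
  have "F t = F 0 - m * t" if "0 \<le> t" "ereal t < x0" for t
    using m(2)[of t] that by (cases "t = 0") (auto simp: I_def)
  from hartogs_affine_isometric_to_hyperbolic[OF opD F0 m(1) this] show ?thesis .
qed

end
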